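(* For a given convex body $K\in\mathbb{K}^n$ and a vector $v\in\mathcal{F}(K)$, the function $T_{k,K,v}:\mathbb{K}^n\to\mathbb{R}^n$ (for integers $k\ge 1$) has the following properties: 1. There exists $k_0\in\mathbb{Z}_+$ such that for every $k\ge k_0$, $T_{k,K,v}(L)$ is defined for all $L\in\mathbb{K}^n$. 2. $T_{k,K,v}$ is an affine-invariant point if defined. 3. $T_{k,K,v}(K)\to v$ as $k\to\infty$.
   Context: $\mathbb{K}^n$ is the set of all convex bodies in $\mathbb{R}^n$ with the Hausdorff metric; $\mathbb{K}^n_1$ is the set of all convex compact sets in $\mathbb{R}^n$ with volume $1$. $\mu$ denotes Lebesgue measure on $\mathbb{R}^n$ and $|L|=\mu(L)$ for a convex body $L$. An affine-invariant point is a function $P:\mathbb{K}^n\to\mathbb{R}^n$ that is continuous in the Hausdorff metric and satisfies $P(\varphi(K))=\varphi(P(K))$ for every nonsingular affine map $\varphi:\mathbb{R}^n\to\mathbb{R}^n$ and every $K\in\mathbb{K}^n$. $\mathcal{F}(K)$ is the set of points of $\mathbb{R}^n$ fixed under all affine maps of $K$ onto itself. $\mathit{SAff}(n)$ is the group of all volume-preserving affine transformations of $\mathbb{R}^n$, i.e. maps $(r,x)(a)=r(a)+x$ with $r\in GL(n,\mathbb{R})$, $\det r=\pm1$, $x\in\mathbb{R}^n$. It is equipped with the (left) Haar measure $d\varphi$, which is the product of the Haar measures on the group of matrices with determinant $\pm1$ and on the group $\mathbb{R}^n$. For $K,L\in\mathbb{K}^n$ and $\varphi\in\mathit{SAff}(n)$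 put $F_K(L)(\varphi)=\mu(\varphi^{-1}(L)\cap K)$. For an integer $k\ge1$, a convex body $K\in\mathbb{K}^n$ and a point $v\in\mathbb{R}^n$, define for $L\in\mathbb{K}^n_1$ $$T_{k,K,v}(L)=\left(\int_{\mathit{SAff}(n)}\bigl(F_K(L)(\varphi)\bigr)^k\,d\varphi\right)^{-1}\int_{\mathit{SAff}(n)}\bigl(F_K(L)(\varphi)\bigr)^k\,\varphi(v)\,d\varphi,$$ and for general $L\in\mathbb{K}^n$ put $$T_{k,K,v}(L)=|L|^{1/n}\,T_{k,K,v}\bigl(L/|L|^{1/n}\bigr).$$ $T_{k,K,v}(L)$ is said to be defined when the integrals in its definition converge.
   Formalization: Property 3 is false for general |K| (L is normalized to volume 1 but K is not); it is proved when |K|=1, and for every K with the kernel body and vector rescaled: T_{k,K/|K|^{1/n},v/|K|^{1/n}}(K)→v. *)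

theory Defs
  imports "HOL-Analysis.Analysis"
begin

definition convex_body :: "(real ^ 'n) set \<Rightarrow> bool" where
  "convex_body K \<longleftrightarrow> compact K \<and> convex K \<and> interior K \<noteq> {}"

text \<open>Only used for nonempty compact sets, where the suprema exist.\<close>

definition hausdorff_dist :: "'a::metric_space set \<Rightarrow> 'a set \<Rightarrow> real" where
  "hausdorff_dist K L = max (SUP x\<in>K. infdist x L) (SUP y\<in>L. infdist y K)"

text \<open>The affine map written \<open>(r, x)(a) = r(a) + x\<close>.\<close>

definition aff :: "(real ^ 'n ^ 'n) \<times> (real ^ 'n) \<Rightarrow> real ^ 'n \<Rightarrow> real ^ 'n" where
  "aff \<phi> a = fst \<phi> *v a + snd \<phi>"

definition affine_invariant_point :: "((real ^ 'n) set \<Rightarrow> real ^ 'n) \<Rightarrow> bool" where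
  "affine_invariant_point P \<longleftrightarrow>
     (\<forall>K. convex_body K \<longrightarrow> (\<forall>e>0. \<exists>d>0. \<forall>L. convex_body L \<and> hausdorff_dist K L < d
        \<longrightarrow> dist (P K) (P L) < e)) \<and>
     (\<forall>\<phi> K. invertible (fst \<phi>) \<and> convex_body K \<longrightarrow> P (aff \<phi> ` K) = aff \<phi> (P K))"

definition fixed_points :: "(real ^ 'n) set \<Rightarrow> (real ^ 'n) set" where
  "fixed_points K = {p. \<forall>\<phi>. aff \<phi> ` K = K \<longrightarrow> aff \<phi> p = p}"

definition unimodular_matrices :: "(real ^ 'n ^ 'n) set" where
  "unimodular_matrices = {r. det r = 1 \<or> det r = -1}"

text \<open>
  Left Haar measures on a group with carrier \<open>G\<close> and multiplication \<open>m\<close>, whose topology is the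
  subspace topology. Regularity is not listed: on a locally compact, second countable group it
  follows from finiteness on compact sets.
\<close>

definition left_haar_measure ::
    "('a::topological_space \<Rightarrow> 'a \<Rightarrow> 'a) \<Rightarrow> 'a set \<Rightarrow> 'a measure \<Rightarrow> bool" where
  "left_haar_measure m G \<nu> \<longleftrightarrow>
     sets \<nu> = sets (restrict_space borel G) \<and>
     emeasure \<nu> G \<noteq> 0 \<and>
     (\<forall>C. compact C \<and> C \<subseteq> G \<longrightarrow> emeasure \<nu> C < \<infinity>) \<and>
     (\<forall>g\<in>G. \<forall>B\<in>sets \<nu>. emeasure \<nu> (m g ` B) = emeasure \<nu> B)"

text \<open>
  The group \<open>SAff(n)\<close> is \<open>unimodular_matrices \<times> UNIV\<close>, acting through \<^const>\<open>aff\<close>; its Haar measure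
  is the product of a Haar measure \<open>\<nu>\<close> on the matrices and Lebesgue measure. Haar measures being
  unique only up to a constant factor, \<open>\<nu>\<close> is a parameter; the factor cancels in \<open>T_point\<close> below.
\<close>

definition saff_measure ::
    "(real ^ 'n ^ 'n) measure \<Rightarrow> ((real ^ 'n ^ 'n) \<times> (real ^ 'n)) measure" where
  "saff_measure \<nu> = \<nu> \<Otimes>\<^sub>M lborel"

definition overlap ::
    "(real ^ 'n) set \<Rightarrow> (real ^ 'n) set \<Rightarrow> (real ^ 'n ^ 'n) \<times> (real ^ 'n) \<Rightarrow> real" where
  "overlap K L \<phi> = measure lebesgue ((aff \<phi> -` L) \<inter> K)"

definition T_unit :: "(real ^ 'n ^ 'n) measure \<Rightarrow> nat \<Rightarrow> (real ^ 'n) set \<Rightarrow> real ^ 'n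
    \<Rightarrow> (real ^ 'n) set \<Rightarrow> real ^ 'n" where
  "T_unit \<nu> k K v L =
     inverse (\<integral>\<phi>. (overlap K L \<phi>) ^ k \<partial>(saff_measure \<nu>)) *\<^sub>R
     (\<integral>\<phi>. (overlap K L \<phi>) ^ k *\<^sub>R aff \<phi> v \<partial>(saff_measure \<nu>))"

definition T_unit_defined :: "(real ^ 'n ^ 'n) measure \<Rightarrow> nat \<Rightarrow> (real ^ 'n) set \<Rightarrow> real ^ 'n
    \<Rightarrow> (real ^ 'n) set \<Rightarrow> bool" where
  "T_unit_defined \<nu> k K v L \<longleftrightarrow>
     integrable (saff_measure \<nu>) (\<lambda>\<phi>. (overlap K L \<phi>) ^ k) \<and>
     integrable (saff_measure \<nu>) (\<lambda>\<phi>. (overlap K L \<phi>) ^ k *\<^sub>R aff \<phi> v)"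

definition vol_root :: "(real ^ 'n) set \<Rightarrow> real" where
  "vol_root (L :: (real ^ 'n) set) = root CARD('n) (measure lebesgue L)"

definition normalized :: "(real ^ 'n) set \<Rightarrow> (real ^ 'n) set" where
  "normalized L = (\<lambda>x. x /\<^sub>R vol_root L) ` L"

text \<open>
  Only \<open>L\<close> is rescaled to unit volume here, not \<open>K\<close>. Convergence of \<open>T_point \<nu> k K v K\<close> to \<open>v\<close>
  therefore requires \<open>K\<close> to have volume 1: otherwise the maximal overlap of \<open>K\<close> with the images of
  \<open>normalized K\<close> is not attained exactly at the symmetries of \<open>K\<close>, and the limit may differ from \<open>v\<close>.
\<close>

definition T_point :: "(real ^ 'n ^ 'n) measure \<Rightarrow> nat \<Rightarrow> (real ^ 'n) set \<Rightarrow> real ^ 'n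
    \<Rightarrow> (real ^ 'n) set \<Rightarrow> real ^ 'n" where
  "T_point \<nu> k K v L = vol_root L *\<^sub>R T_unit \<nu> k K v (normalized L)"

definition T_defined :: "(real ^ 'n ^ 'n) measure \<Rightarrow> nat \<Rightarrow> (real ^ 'n) set \<Rightarrow> real ^ 'n
    \<Rightarrow> (real ^ 'n) set \<Rightarrow> bool" where
  "T_defined \<nu> k K v L \<longleftrightarrow> T_unit_defined \<nu> k K v (normalized L)"

end

theory Submission
  imports Defs
begin

text \<open>
  The overlap is at most \<open>C / (1 + \<parallel>r\<parallel>)\<close> and, for fixed \<open>r\<close>, supported in \<open>\<parallel>x\<parallel> \<le> \<rho> (1 + \<parallel>r\<parallel>)\<close>, while
  the Haar measure of \<open>{\<parallel>r\<parallel> \<le> N}\<close> grows polynomially in \<open>N\<close>; hence high powers of the overlap are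
  integrable. Equivariance is left invariance of the measure on \<open>SAff(n)\<close>. Continuity follows by
  dominated convergence, because Hausdorff convergence of convex bodies implies convergence of their
  indicators off the boundary of the limit, which is a null set. If \<open>K\<close> has volume 1, the overlap of
  \<open>K\<close> with itself is at most 1, with equality exactly at the affine symmetries of \<open>K\<close>, all of which
  fix \<open>v\<close>; as \<open>k\<close> grows, the \<open>k\<close>-th powers concentrate near these symmetries.
\<close>

section \<open>Affine maps and Lebesgue measure\<close>

text \<open>Nothing is known of the Haar measure beyond invariance, finiteness on compact sets and
  nontriviality, so every estimate on the matrix group comes from translating one neighbourhood of
  the identity: translates of a compact one cover large balls and bound their measure, and countably
  many translates of an arbitrarily small one cover the group and force its measure to be positive.
  The group is not compact, so attaining the maximal overlap only at the symmetries does not by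
  itself give concentration. The decay and support estimates therefore serve twice: they yield the
  integrable majorant, and they confine all maps with overlap at least 1/2 to a compact set, which
  makes the closeness of \<open>aff \<phi> v\<close> to \<open>v\<close> uniform near overlap 1.
  Left multiplication in SAff(n) acts on the matrix and on the translation separately, so its
  invariance splits into the Haar property and the invariance of Lebesgue measure.\<close>

lemma bounded_bilinear_matrix_vector_mult:
  "bounded_bilinear ((*v) :: real ^ 'n ^ 'm \<Rightarrow> real ^ 'n \<Rightarrow> real ^ 'm)"
  unfolding bilinear_conv_bounded_bilinear[symmetric] bilinear_def
  by (auto intro!: linearI simp: matrix_vector_mult_add_rdistrib matrix_vector_right_distrib
      scaleR_matrix_vector_assoc matrix_vector_mult_scaleR)

lemma bounded_bilinear_matrix_matrix_mult:
  "bounded_bilinear ((**) :: real ^ 'n ^ 'm \<Rightarrow> real ^ 'p ^ 'n \<Rightarrow> real ^ 'p ^ 'm)"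
  unfolding bilinear_conv_bounded_bilinear[symmetric] bilinear_def
  by (auto intro!: linearI simp: matrix_matrix_mult_def vec_eq_iff sum.distrib sum_distrib_left
      algebra_simps)

lemmas tendsto_matrix_vector_mult [tendsto_intros] =
  bounded_bilinear.tendsto[OF bounded_bilinear_matrix_vector_mult]

lemmas continuous_on_matrix_vector_mult [continuous_intros] =
  bounded_bilinear.continuous_on[OF bounded_bilinear_matrix_vector_mult]

lemmas continuous_on_matrix_matrix_mult [continuous_intros] =
  bounded_bilinear.continuous_on[OF bounded_bilinear_matrix_matrix_mult]

lemma continuous_on_det [continuous_intros]:
  fixes f :: "'a::topological_space \<Rightarrow> real ^ 'n ^ 'n"
  shows "continuous_on S f \<Longrightarrow> continuous_on S (\<lambda>x. det (f x))"
  unfolding det_def by (intro continuous_intros) auto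

text \<open>The norm on matrices as vectors of rows is the Frobenius norm, so Cauchy-Schwarz in each
  row suffices.\<close>

lemma norm_matrix_vector_mult_le:
  fixes A :: "real ^ 'n ^ 'm"
  shows "norm (A *v x) \<le> norm A * norm x"
proof -
  have "norm (A *v x) \<le> L2_set (\<lambda>i. norm (A $ i) * norm x) UNIV"
    unfolding norm_vec_def[of "A *v x"]
    by (intro L2_set_mono) (simp_all add: matrix_mult_dot Cauchy_Schwarz_ineq2)
  also have "\<dots> = norm A * norm x"
    by (simp add: norm_vec_def[of A] L2_set_left_distrib)
  finally show ?thesis .
qed

lemma matrix_entry_le_norm: "\<bar>(A :: real ^ 'n ^ 'm) $ i $ j\<bar> \<le> norm A"
  using component_le_norm_cart[of "A $ i" j] Finite_Cartesian_Product.norm_nth_le[of A i] by linarith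

lemma norm_matrix_le_of_entries:
  fixes A :: "real ^ 'n ^ 'm"
  assumes "\<And>i j. \<bar>A $ i $ j\<bar> \<le> B"
  shows "norm A \<le> real CARD('m) * (real CARD('n) * B)"
proof -
  have *: "norm (A $ i) \<le> real CARD('n) * B" for i
    using norm_le_l1_cart[of "A $ i"] sum_mono[of UNIV "\<lambda>j. \<bar>A $ i $ j\<bar>" "\<lambda>_. B"] assms by simp
  have "norm A \<le> (\<Sum>i\<in>UNIV. norm (A $ i))"
    unfolding norm_vec_def by (rule L2_set_le_sum) simp
  also have "\<dots> \<le> (\<Sum>i\<in>(UNIV::'m set). real CARD('n) * B)"
    by (intro sum_mono *)
  finally show ?thesis by simp
qed

section \<open>The group of matrices of determinant +-1\<close>

lemma closed_unimodular_matrices: "closed (unimodular_matrices :: (real ^ 'n ^ 'n) set)"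
proof -
  have "closed {r :: real ^ 'n ^ 'n. det r = c}" for c
    by (intro closed_Collect_eq continuous_intros)
  then show ?thesis
    unfolding unimodular_matrices_def by (simp add: Collect_disj_eq closed_Un)
qed

lemma unimodular_one [simp]: "mat 1 \<in> unimodular_matrices"
  by (simp add: unimodular_matrices_def)

lemma unimodular_mult:
  "r \<in> unimodular_matrices \<Longrightarrow> s \<in> unimodular_matrices \<Longrightarrow> r ** s \<in> unimodular_matrices"
  by (auto simp: unimodular_matrices_def det_mul)

lemma unimodular_abs_det: "r \<in> unimodular_matrices \<longleftrightarrow> \<bar>det r\<bar> = 1"
  by (auto simp: unimodular_matrices_def)

lemma unimodular_invertible: "r \<in> unimodular_matrices \<Longrightarrow> invertible r"
  by (auto simp: unimodular_matrices_def invertible_det_nz)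

lemma unimodular_inverseE:
  assumes "r \<in> unimodular_matrices"
  obtains s where "s \<in> unimodular_matrices" "r ** s = mat 1" "s ** r = mat 1"
proof -
  obtain s where s: "r ** s = mat 1" "s ** r = mat 1"
    using unimodular_invertible[OF assms] by (auto simp: invertible_def)
  have "det r * det s = 1"
    using s(1) det_mul[of r s] by simp
  then have "s \<in> unimodular_matrices"
    using assms by (auto simp: unimodular_matrices_def)
  with s that show ?thesis by blast
qed

section \<open>Affine maps: composition, inverses and continuity\<close>

lemma aff_aff: "aff (r, x) (aff (s, y) a) = aff (r ** s, r *v y + x) a"
  by (simp add: aff_def matrix_vector_right_distrib matrix_vector_mul_assoc add.assoc)

lemma aff_one [simp]: "aff (mat 1, 0) = id"
  by (auto simp: aff_def)

lemma aff_inverseE: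
  assumes "invertible r"
  obtains s y where "r ** s = mat 1" "s ** r = mat 1"
    "\<And>a. aff (s, y) (aff (r, x) a) = a" "\<And>a. aff (r, x) (aff (s, y) a) = a"
proof -
  obtain s where s: "r ** s = mat 1" "s ** r = mat 1"
    using assms by (auto simp: invertible_def)
  show thesis
  proof (rule that[of s "- (s *v x)"])
    show "aff (s, - (s *v x)) (aff (r, x) a) = a" for a
      by (simp add: aff_aff s)
    have "r *v (- (s *v x)) + x = 0"
      by (simp add: linear_neg matrix_vector_mul_assoc s)
    then show "aff (r, x) (aff (s, - (s *v x)) a) = a" for a
      by (simp add: aff_aff s)
  qed (use s in auto)
qed

lemma vimage_eq_image_of_inverse:
  assumes "\<And>a. f (g a) = a" "\<And>a. g (f a) = a"
  shows "f -` S = g ` S"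
  using assms by (auto simp: image_iff) metis

lemma continuous_on_aff [continuous_intros]:
  assumes "continuous_on S f" "continuous_on S g"
  shows "continuous_on S (\<lambda>x. aff (f x) (g x))"
  unfolding aff_def by (intro continuous_intros assms)

lemma tendsto_aff [tendsto_intros]:
  assumes "(f \<longlongrightarrow> \<phi>) F" "(g \<longlongrightarrow> a) F"
  shows "((\<lambda>x. aff (f x) (g x)) \<longlongrightarrow> aff \<phi> a) F"
  unfolding aff_def by (intro tendsto_intros assms)

lemma aff_image_eq: "aff (r, x) ` S = (+) x ` ((*v) r ` S)"
  by (auto simp: aff_def image_image add.commute)

text \<open>The matrix is the identity with row \<open>n\<close> added to row \<open>m\<close>, and
  a row operation preserves the determinant.\<close>

lemma det_shear:
  assumes "m \<noteq> n"
  shows "det (matrix (\<lambda>v :: real ^ 'n. \<chi> i. if i = m then v $ m + v $ n else v $ i)) = 1"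
proof -
  have "matrix (\<lambda>v :: real ^ 'n. \<chi> i. if i = m then v $ m + v $ n else v $ i) =
      (\<chi> k. if k = m then row m (mat 1) + 1 *s row n (mat 1) else row k (mat 1))"
    by (auto simp: matrix_def row_def vec_eq_iff mat_def axis_def)
  then show ?thesis
    using det_row_operation[OF assms, where c = 1 and A = "mat 1 :: real ^ 'n ^ 'n"] by simp
qed

text \<open>
  The library versions of the next two facts require a well-ordered index type, which enters only
  through the determinant of a shear.
\<close>

lemma
  fixes f :: "real ^ 'n \<Rightarrow> real ^ 'n"
  assumes "linear f" "S \<in> lmeasurable"
  shows lmeasurable_linear_image: "f ` S \<in> lmeasurable"
    and measure_linear_image_det: "measure lebesgue (f ` S) = \<bar>det (matrix f)\<bar> * measure lebesgue S"
proof -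
  let ?P = "\<lambda>f :: real ^ 'n \<Rightarrow> real ^ 'n. \<forall>S\<in>lmeasurable. f ` S \<in> lmeasurable \<and>
    measure lebesgue (f ` S) = \<bar>det (matrix f)\<bar> * measure lebesgue S"
  \<comment> \<open>For determinant +-1, preserving the volume of boxes is enough; coordinate swaps
    and shears are then tested on boxes only.\<close>
  have suff: "?P f" if "linear f" "\<bar>det (matrix f)\<bar> = 1"
    "\<And>a b. cbox a b \<noteq> {} \<Longrightarrow> measure lebesgue (f ` cbox a b) = measure lebesgue (cbox a b)" for f
  proof -
    have "measure lebesgue (f ` cbox a b) = 1 * measure lebesgue (cbox a b)" for a b
      using that(3)[of a b] by (cases "cbox a b = {}") auto
    then show ?thesis
      using measure_linear_sufficient[OF that(1)] that(2) by (metis mult_1)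
  qed
  have "?P f"
  proof (rule induct_linear_elementary[OF assms(1)])
    show "?P (f \<circ> g)" if "linear f" "linear g" "?P f" "?P g" for f g
      unfolding matrix_compose[OF that(2,1)] image_comp[symmetric]
      using that(3,4) by (simp add: abs_mult det_mul)
  next
    show "?P f" if "linear f" "\<And>x. f x $ i = 0" for f i
    proof -
      have "\<not> surj f"
        using that(2) by (metis one_neq_zero surjE vec_component)
      then have "\<not> inj f"
        using linear_injective_imp_surjective[OF that(1)] by blast
      then have "det (matrix f) = 0" "negligible (f ` S)" for S
        using det_nz_iff_inj[OF that(1)] negligible_linear_singular_image[OF that(1)] by auto
      then show ?thesis
        by (simp add: negligible_iff_measure)
    qed
  next
    show "?P (\<lambda>x. \<chi> i. c i * x $ i)" for c
      by (simp add: measurable_stretch measure_stretch axis_def matrix_def det_diagonal)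
  next
    fix m n :: 'n
    define h where "h = (\<lambda>x :: real ^ 'n. \<chi> i. x $ Transposition.transpose m n i)"
    have lin: "linear h"
      unfolding h_def by (rule linearI) (simp_all add: vec_eq_iff)
    have hh: "h \<circ> h = id"
      by (auto simp: h_def vec_eq_iff)
    \<comment> \<open>The determinant of an involution squares to 1, so the sign of the
      transposition is never computed.\<close>
    then have "det (matrix h) * det (matrix h) = 1"
      by (metis matrix_compose[OF lin lin] det_mul det_I matrix_id_mat_1)
    then have "\<bar>det (matrix h)\<bar> = 1"
      by (auto simp: square_eq_1_iff)
    moreover have "measure lebesgue (h ` cbox a b) = measure lebesgue (cbox a b)"
      if "cbox a b \<noteq> {}" for a b
    proof -
      have "h ` cbox a b = h -` cbox a b"
        using hh by (auto simp: fun_eq_iff image_iff) metis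
      also have "\<dots> = cbox (h a) (h b)"
        unfolding h_def by (auto simp: mem_box_cart) (metis transpose_involutory)+
      finally have eq: "h ` cbox a b = cbox (h a) (h b)" .
      have "prod (\<lambda>i. (h b - h a) $ i) UNIV = prod (\<lambda>i. (b - a) $ i) UNIV"
        unfolding h_def using bij_transpose[of m n]
        by (simp add: prod.reindex_bij_betw[of "Transposition.transpose m n" UNIV UNIV "\<lambda>i. (b - a) $ i", simplified])
      moreover have "cbox (h a) (h b) \<noteq> {}"
        using that eq by (metis image_is_empty)
      ultimately show ?thesis
        unfolding eq using that by (simp add: content_cbox_cart)
    qed
    ultimately show "?P (\<lambda>x. \<chi> i. x $ Transposition.transpose m n i)"
      using suff[OF lin] unfolding h_def by blast
  next
    fix m n :: 'n
    assume "m \<noteq> n"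
    define h where "h = (\<lambda>v :: real ^ 'n. \<chi> i. if i = m then v $ m + v $ n else v $ i)"
    have lin: "linear h"
      unfolding h_def by (rule linearI) (simp_all add: vec_eq_iff algebra_simps)
    have "measure lebesgue (h ` cbox a b) = measure lebesgue (cbox a b)"
      if "cbox a b \<noteq> {}" for a b
    proof -
      \<comment> \<open>\<open>measure_shear_interval\<close> asks for a nonnegative
        \<open>n\<close>-th coordinate of the lower corner; translating that corner to the origin
        provides it.\<close>
      have "cbox a b = (+) a ` cbox 0 (b - a)"
        using cbox_translation[of a 0 "b - a"] by simp
      then have "h ` cbox a b = (+) (h a) ` h ` cbox 0 (b - a)"
        by (auto simp: image_image linear_add[OF lin])
      then have "measure lebesgue (h ` cbox a b) = measure lebesgue (h ` cbox 0 (b - a))"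
        by (simp add: measure_translation)
      also have "\<dots> = measure lebesgue (cbox 0 (b - a))"
        unfolding h_def using \<open>m \<noteq> n\<close> that \<open>cbox a b = _\<close> by (subst measure_shear_interval) auto
      also have "\<dots> = measure lebesgue (cbox a b)"
        unfolding \<open>cbox a b = _\<close> by (rule measure_translation[symmetric])
      finally show ?thesis .
    qed
    then show "?P (\<lambda>v. \<chi> i. if i = m then v $ m + v $ n else v $ i)"
      using suff[OF lin] det_shear[OF \<open>m \<noteq> n\<close>] unfolding h_def by simp
  qed
  with assms(2) show "f ` S \<in> lmeasurable"
    "measure lebesgue (f ` S) = \<bar>det (matrix f)\<bar> * measure lebesgue S" by auto
qed

lemma measure_aff_image:
  assumes "S \<in> lmeasurable"
  shows "measure lebesgue (aff (r, x) ` S) = \<bar>det r\<bar> * measure lebesgue S"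
  using measure_linear_image_det[OF matrix_vector_mul_linear[of r] assms]
  by (simp add: aff_image_eq measure_translation)

lemma lmeasurable_aff_image: "S \<in> lmeasurable \<Longrightarrow> aff (r, x) ` S \<in> lmeasurable"
  by (simp add: aff_image_eq lmeasurable_linear_image measurable_translation)

lemma negligible_aff_image: "negligible S \<Longrightarrow> negligible (aff (r, x) ` S)"
  by (auto simp: negligible_iff_measure lmeasurable_aff_image measure_aff_image)

lemma negligible_aff_vimage:
  assumes "invertible (fst \<phi>)" "negligible S"
  shows "negligible (aff \<phi> -` S)"
proof -
  obtain r x where \<phi>: "\<phi> = (r, x)" by (cases \<phi>)
  with assms obtain s y where "\<And>a. aff (s, y) (aff (r, x) a) = a" "\<And>a. aff (r, x) (aff (s, y) a) = a"
    by (metis aff_inverseE fst_conv)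
  then have "aff \<phi> -` S = aff (s, y) ` S"
    unfolding \<phi> by (intro vimage_eq_image_of_inverse)
  then show ?thesis
    by (simp add: negligible_aff_image assms)
qed

lemma compact_aff_image: "compact S \<Longrightarrow> compact (aff \<phi> ` S)"
  by (intro compact_continuous_image continuous_intros)

lemma closed_aff_vimage: "closed S \<Longrightarrow> closed (aff \<phi> -` S)"
  by (intro closed_vimage) (auto intro!: continuous_intros simp: aff_def)

lemma borel_measurable_aff [measurable]: "aff \<phi> \<in> borel_measurable borel"
  by (intro borel_measurable_continuous_onI continuous_intros)

lemma convex_aff_image: "convex S \<Longrightarrow> convex (aff (r, x) ` S)"
  by (simp add: aff_image_eq convex_translation convex_linear_image)

text \<open>The Lebesgue half of the invariance of the product measure. Values on boxes determine
  \<open>lborel\<close>, and the preimage of a box is its image under the inverse map, which also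
  has determinant +-1.\<close>

lemma distr_lborel_aff:
  assumes "r \<in> unimodular_matrices"
  shows "distr lborel borel (aff (r, x)) = lborel"
proof (rule lborel_eqI[symmetric])
  fix l u :: "real ^ 'a"
  assume lu: "\<And>b. b \<in> Basis \<Longrightarrow> l \<bullet> b \<le> u \<bullet> b"
  obtain s y where s: "r ** s = mat 1" "\<And>a. aff (s, y) (aff (r, x) a) = a" "\<And>a. aff (r, x) (aff (s, y) a) = a"
    using aff_inverseE[OF unimodular_invertible[OF assms], of x] by metis
  have "\<bar>det s\<bar> = 1"
    using s(1) det_mul[of r s] assms by (auto simp: unimodular_matrices_def)
  have eq: "aff (r, x) -` box l u = aff (s, y) ` box l u"
    by (rule vimage_eq_image_of_inverse) (use s in auto)
  have borel: "aff (r, x) -` box l u \<in> sets borel"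
    using measurable_sets[OF borel_measurable_aff, of "box l u" "(r, x)"] by simp
  have lm: "aff (s, y) ` box l u \<in> lmeasurable"
    by (intro lmeasurable_aff_image) simp
  have "emeasure (distr lborel borel (aff (r, x))) (box l u) = emeasure lborel (aff (r, x) -` box l u)"
    by (subst emeasure_distr) auto
  also have "\<dots> = emeasure lebesgue (aff (s, y) ` box l u)"
    using borel by (simp add: eq)
  also have "\<dots> = ennreal (measure lebesgue (aff (s, y) ` box l u))"
    using lm by (simp add: emeasure_eq_measure2 fmeasurableD2)
  also have "measure lebesgue (aff (s, y) ` box l u) = (\<Prod>b\<in>Basis. (u - l) \<bullet> b)"
    using \<open>\<bar>det s\<bar> = 1\<close> lu by (subst measure_aff_image) (auto simp: measure_lborel_box)
  finally show "emeasure (distr lborel borel (aff (r, x))) (box l u) = (\<Prod>b\<in>Basis. (u - l) \<bullet> b)" .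
qed simp

section \<open>Polynomial growth of the Haar measure\<close>

lemma abs_det_le_of_entries:
  fixes A :: "real ^ 'n ^ 'n"
  assumes "\<And>i j. \<bar>A $ i $ j\<bar> \<le> B"
  shows "\<bar>det A\<bar> \<le> fact CARD('n) * B ^ CARD('n)"
proof -
  have "\<bar>det A\<bar> \<le> (\<Sum>p | p permutes (UNIV :: 'n set). \<bar>of_int (sign p) * (\<Prod>i\<in>UNIV. A $ i $ p i)\<bar>)"
    unfolding det_def by (rule sum_abs)
  also have "\<dots> \<le> (\<Sum>p | p permutes (UNIV :: 'n set). B ^ CARD('n))"
  proof (rule sum_mono)
    fix p :: "'n \<Rightarrow> 'n"
    have "\<bar>of_int (sign p) * (\<Prod>i\<in>UNIV. A $ i $ p i)\<bar> = (\<Prod>i\<in>UNIV. \<bar>A $ i $ p i\<bar>)"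
      by (simp add: abs_mult abs_prod del: of_int_abs flip: of_int_abs)
    also have "\<dots> \<le> (\<Prod>i\<in>(UNIV :: 'n set). B)"
      by (rule prod_mono) (simp add: assms)
    finally show "\<bar>of_int (sign p) * (\<Prod>i\<in>UNIV. A $ i $ p i)\<bar> \<le> B ^ CARD('n)" by simp
  qed
  also have "\<dots> = fact CARD('n) * B ^ CARD('n)"
    by (simp add: card_permutations)
  finally show ?thesis .
qed

text \<open>By Cramer's rule an entry of the inverse is, up to sign, the determinant of
  \<open>r\<close> with one column replaced by a basis vector, and the Leibniz formula bounds that
  determinant. \<open>1 \<le> B\<close> covers the entries of the basis vector.\<close>

lemma unimodular_inverse_entries_le:
  fixes r s :: "real ^ 'n ^ 'n"
  assumes "r \<in> unimodular_matrices" "r ** s = mat 1"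
    and "\<And>i j. \<bar>r $ i $ j\<bar> \<le> B" "1 \<le> B"
  shows "\<bar>s $ i $ j\<bar> \<le> fact CARD('n) * B ^ CARD('n)"
proof -
  let ?C = "\<chi> k l. if l = i then axis j 1 $ k else r $ k $ l"
  have "r *v (s *v axis j 1) = axis j 1"
    by (simp add: matrix_vector_mul_assoc assms)
  moreover have "det r \<noteq> 0"
    using assms(1) by (auto simp: unimodular_matrices_def)
  ultimately have "(s *v axis j 1) $ i = det ?C / det r"
    by (simp add: cramer)
  then have "\<bar>s $ i $ j\<bar> = \<bar>det ?C\<bar>"
    using assms(1) by (simp add: unimodular_abs_det matrix_vector_mult_basis column_def abs_divide)
  also have "\<dots> \<le> fact CARD('n) * B ^ CARD('n)"
    using assms(3,4) by (intro abs_det_le_of_entries) (auto simp: axis_def intro: order_trans[of _ 1])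
  finally show ?thesis .
qed

locale unimodular_haar =
  fixes \<nu> :: "(real ^ 'n ^ 'n) measure"
  assumes haar: "left_haar_measure (**) unimodular_matrices \<nu>"
begin

abbreviation (input) G :: "(real ^ 'n ^ 'n) set" where "G \<equiv> unimodular_matrices"

lemma sets_haar: "sets \<nu> = sets (restrict_space borel G)"
  using haar by (simp add: left_haar_measure_def)

lemma space_haar: "space \<nu> = G"
  using sets_eq_imp_space_eq[OF sets_haar] by (simp add: space_restrict_space)

lemma sets_haar_iff: "B \<in> sets \<nu> \<longleftrightarrow> B \<subseteq> G \<and> B \<in> sets borel"
  unfolding sets_haar by (subst sets_restrict_space_iff) (auto simp: closed_unimodular_matrices)

lemma measurable_haar_iff: "f \<in> measurable \<nu> M \<longleftrightarrow> f \<in> measurable (restrict_space borel G) M"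
  using measurable_cong_sets[OF sets_haar refl] by blast

lemma borel_measurable_haar_ident [measurable]: "(\<lambda>r. r) \<in> borel_measurable \<nu>"
  unfolding measurable_haar_iff by (rule measurable_restrict_space1) simp

lemma emeasure_haar_compact: "compact C \<Longrightarrow> C \<subseteq> G \<Longrightarrow> emeasure \<nu> C < \<infinity>"
  using haar by (simp add: left_haar_measure_def)

lemma emeasure_haar_image: "g \<in> G \<Longrightarrow> B \<in> sets \<nu> \<Longrightarrow> emeasure \<nu> ((**) g ` B) = emeasure \<nu> B"
  using haar by (simp add: left_haar_measure_def)

lemma emeasure_haar_nonzero: "emeasure \<nu> G \<noteq> 0"
  using haar by (simp add: left_haar_measure_def)

lemma compact_haar_cball: "compact (G \<inter> cball a R)"
  by (intro closed_Int_compact closed_unimodular_matrices compact_cball)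

sublocale haar: sigma_finite_measure \<nu>
proof
  show "\<exists>A. countable A \<and> A \<subseteq> sets \<nu> \<and> \<Union> A = space \<nu> \<and> (\<forall>a\<in>A. emeasure \<nu> a \<noteq> \<infinity>)"
  proof (intro exI conjI ballI)
    show "countable (range (\<lambda>n :: nat. G \<inter> cball 0 (real n)))" by simp
    show "range (\<lambda>n :: nat. G \<inter> cball 0 (real n)) \<subseteq> sets \<nu>"
      by (auto simp: sets_haar_iff closed_unimodular_matrices)
    show "(\<Union>n :: nat. G \<inter> cball 0 (real n)) = space \<nu>"
      by (auto simp: space_haar real_arch_simple)
    show "emeasure \<nu> a \<noteq> \<infinity>" if "a \<in> range (\<lambda>n :: nat. G \<inter> cball 0 (real n))" for a
      using that emeasure_haar_compact[OF compact_haar_cball] by (auto simp: less_top)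
  qed
qed

text \<open>Invariance is formulated for images, while measurability and \<open>distr\<close> speak
  of preimages. A translate by \<open>g\<close> is a preimage under translation by the inverse
  \<open>h\<close>.\<close>

lemma left_mult_image_eq:
  assumes "g \<in> G" "h ** g = mat 1" "g ** h = mat 1" "B \<subseteq> G"
  shows "(**) g ` B = {r \<in> G. h ** r \<in> B}"
proof (intro set_eqI iffI)
  fix r
  assume "r \<in> (**) g ` B"
  then show "r \<in> {r \<in> G. h ** r \<in> B}"
    using assms unimodular_mult by (auto simp: matrix_mul_assoc)
next
  fix r
  assume "r \<in> {r \<in> G. h ** r \<in> B}"
  moreover have "r = g ** (h ** r)"
    by (simp add: matrix_mul_assoc assms)
  ultimately show "r \<in> (**) g ` B"
    by blast
qed

lemma measurable_left_mult [measurable]: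
  assumes "g \<in> G"
  shows "(**) g \<in> measurable \<nu> \<nu>"
proof -
  have "(**) g \<in> borel_measurable \<nu>"
    unfolding measurable_haar_iff
    by (intro borel_measurable_continuous_on_restrict continuous_intros)
  then have "(**) g \<in> measurable \<nu> (restrict_space borel G)"
    using assms by (intro measurable_restrict_space2) (auto simp: space_haar unimodular_mult)
  then show ?thesis
    using measurable_cong_sets[OF refl sets_haar] by blast
qed

lemma distr_left_mult:
  assumes "g \<in> G"
  shows "distr \<nu> \<nu> ((**) g) = \<nu>"
proof (rule measure_eqI)
  fix B assume "B \<in> sets (distr \<nu> \<nu> ((**) g))"
  then have B: "B \<in> sets \<nu>" by simp
  then have "B \<subseteq> G" by (simp add: sets_haar_iff)
  obtain h where h: "h \<in> G" "g ** h = mat 1" "h ** g = mat 1"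
    using unimodular_inverseE[OF assms] by blast
  have "emeasure (distr \<nu> \<nu> ((**) g)) B = emeasure \<nu> ((**) g -` B \<inter> space \<nu>)"
    using B assms by (intro emeasure_distr) auto
  also have "(**) g -` B \<inter> space \<nu> = (**) h ` B"
    using left_mult_image_eq[OF h \<open>B \<subseteq> G\<close>] by (auto simp: space_haar)
  also have "emeasure \<nu> \<dots> = emeasure \<nu> B"
    by (rule emeasure_haar_image) fact+
  finally show "emeasure (distr \<nu> \<nu> ((**) g)) B = emeasure \<nu> B" .
qed simp

text \<open>If the ball were null, so would be all its translates. They are relatively open and
  cover \<open>G\<close>, so by Lindelof countably many of them cover it, and \<open>G\<close>
  itself would be null.\<close>

lemma emeasure_haar_ball_pos:
  assumes "0 < e"
  shows "emeasure \<nu> (G \<inter> ball (mat 1) e) > 0"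
proof (rule ccontr)
  let ?V = "G \<inter> ball (mat 1) e"
  assume "\<not> emeasure \<nu> ?V > 0"
  then have V: "emeasure \<nu> ?V = 0" by simp
  have VM: "?V \<in> sets \<nu>"
    by (auto simp: sets_haar_iff closed_unimodular_matrices)
  have op: "openin (top_of_set G) ((**) g ` ?V)" if g: "g \<in> G" for g
  proof -
    obtain h where h: "h \<in> G" "g ** h = mat 1" "h ** g = mat 1"
      using unimodular_inverseE[OF g] by blast
    have "(**) g ` ?V = G \<inter> (\<lambda>r. h ** r) -` ball (mat 1) e"
      using left_mult_image_eq[OF g h(3,2), of ?V] h(1) by (auto simp: unimodular_mult)
    moreover have "open ((\<lambda>r. h ** r) -` ball (mat 1) e)"
      by (intro open_vimage continuous_intros) auto
    ultimately show ?thesis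
      by (auto simp: openin_open)
  qed
  obtain F where F: "F \<subseteq> (\<lambda>g. (**) g ` ?V) ` G" "countable F" "\<Union>F = (\<Union>g\<in>G. (**) g ` ?V)"
    using Lindelof_openin[of "(\<lambda>g. (**) g ` ?V) ` G" G] op by blast
  have inV: "g \<in> (**) g ` ?V" if "g \<in> G" for g
    using that assms by (intro image_eqI[of _ _ "mat 1"]) auto
  have subG: "(**) g ` ?V \<subseteq> G" if "g \<in> G" for g
    using that by (auto simp: unimodular_mult)
  have "\<Union>F = G"
    unfolding F(3)
  proof (intro equalityI UN_least subG)
    show "G \<subseteq> (\<Union>g\<in>G. (**) g ` ?V)"
    proof
      fix g assume "g \<in> G"
      then show "g \<in> (\<Union>g\<in>G. (**) g ` ?V)"
        by (rule UN_I) (rule inV[OF \<open>g \<in> G\<close>])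
    qed
  qed
  have "A \<in> null_sets \<nu>" if AF: "A \<in> F" for A
  proof -
    obtain g where g: "g \<in> G" "A = (**) g ` ?V"
      using subsetD[OF F(1) AF] by (elim imageE)
    obtain T where T: "open T" "A = G \<inter> T"
      using op[OF g(1)] unfolding g(2) openin_open by (elim exE conjE)
    have "A \<in> sets \<nu>"
      unfolding sets_haar_iff T(2)
      using T(1) borel_closed[OF closed_unimodular_matrices] by auto
    then show ?thesis
      using emeasure_haar_image[OF g(1) VM] V g(2) by (simp add: null_sets_def)
  qed
  then have "(\<Union>A\<in>F. A) \<in> null_sets \<nu>"
    by (intro null_sets_UN' F(2))
  then show False
    using \<open>\<Union>F = G\<close> emeasure_haar_nonzero by auto
qed

lemma left_mult_image_sets:
  assumes "g \<in> G" "B \<in> sets \<nu>"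
  shows "(**) g ` B \<in> sets \<nu>"
proof -
  have "B \<subseteq> G" using assms(2) by (simp add: sets_haar_iff)
  obtain h where h: "h \<in> G" "g ** h = mat 1" "h ** g = mat 1"
    using unimodular_inverseE[OF assms(1)] by blast
  have "(**) g ` B = (**) h -` B \<inter> space \<nu>"
    using left_mult_image_eq[OF assms(1) h(3,2) \<open>B \<subseteq> G\<close>] by (auto simp: space_haar)
  then show ?thesis
    using measurable_sets[OF measurable_left_mult[OF h(1)] assms(2)] by simp
qed

text \<open>
  Since the inverse of \<open>g\<close> has entries of polynomial size, a left translate \<open>g U\<close> of a fixed compact
  neighbourhood of the identity contains a Euclidean ball around \<open>g\<close> of polynomially small radius.
  Counting the cells of a grid of that mesh bounds the Haar measure of large balls.
\<close>

lemma emeasure_haar_growth: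
  obtains C :: real and p :: nat where "0 \<le> C"
    "\<And>N :: nat. 1 \<le> N \<Longrightarrow> emeasure \<nu> {r \<in> G. norm r \<le> real N} \<le> ennreal (C * real N ^ p)"
proof -
  define n where "n = CARD('n)"
  \<comment> \<open>The bound of \<open>norm_matrix_le_of_entries\<close> for entries of size at
    most 1: \<open>U\<close> contains every element of \<open>G\<close> that differs from the
    identity by at most 1 in each entry.\<close>
  define D where "D = real n * (real n * 1)"
  define U where "U = G \<inter> cball (mat 1) D"
  have U: "U \<in> sets \<nu>" "emeasure \<nu> U < \<infinity>"
    unfolding U_def using emeasure_haar_compact[OF compact_haar_cball]
    by (auto simp: sets_haar_iff closed_unimodular_matrices)
  define u where "u = enn2real (emeasure \<nu> U)"
  have u: "emeasure \<nu> U = ennreal u" "0 \<le> u"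
    using U(2) by (auto simp: u_def less_top)
  \<comment> \<open>There are at most (3 M N)^(n n) cells, with M N = n n! N^(n + 1); each costs one
    copy of \<open>U\<close>.\<close>
  define C where "C = (3 * real n * fact n) ^ (n * n) * u"
  define p where "p = Suc n * (n * n)"
  have "emeasure \<nu> {r \<in> G. norm r \<le> real N} \<le> ennreal (C * real N ^ p)" if N: "1 \<le> N" for N
  proof -
    define B where "B = {r \<in> G. norm r \<le> real N}"
    \<comment> \<open>Cells of side 1 / \<open>M\<close>. An entry of \<open>s ** (h - g)\<close>
      has \<open>n\<close> terms, each at most \<open>fact n * N ^ n\<close> (inverse entry) times 1
      / \<open>M\<close> (same cell), hence total at most 1.\<close>
    define M where "M = n * fact n * N ^ n"
    have n1: "1 \<le> n" by (simp add: n_def Suc_leI)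
    have "1 \<le> M" using n1 N by (simp add: M_def Suc_le_eq)
    define c where "c = (\<lambda>r :: real ^ 'n ^ 'n. \<lambda>ij :: 'n \<times> 'n. \<lfloor>real M * r $ fst ij $ snd ij\<rfloor>)"
    define Z where "Z = (UNIV :: ('n \<times> 'n) set) \<rightarrow>\<^sub>E {- int (M * N)..int (M * N)}"
    have finZ: "finite Z" unfolding Z_def by (intro finite_PiE) auto
    have cardZ: "card Z = (2 * (M * N) + 1) ^ (n * n)"
    proof -
      have "nat (2 * (int M * int N) + 1) = Suc (2 * (M * N))"
        by (simp flip: of_nat_mult)
      then show ?thesis
        unfolding Z_def by (simp add: card_PiE n_def)
    qed
    have "c r ij \<in> {- int (M * N)..int (M * N)}" if "r \<in> B" for r ij
    proof -
      have "\<bar>r $ fst ij $ snd ij\<bar> \<le> real N"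
        using that matrix_entry_le_norm[of r "fst ij" "snd ij"] by (simp add: B_def)
      then have "\<bar>real M * r $ fst ij $ snd ij\<bar> \<le> real M * real N"
        by (simp add: abs_mult mult_left_mono)
      then have "- real_of_int (int (M * N)) \<le> real M * r $ fst ij $ snd ij"
        "real M * r $ fst ij $ snd ij \<le> real_of_int (int (M * N))" by auto
      then show ?thesis
        unfolding c_def atLeastAtMost_iff by linarith
    qed
    then have cB: "c ` B \<subseteq> Z"
      by (intro image_subsetI) (simp add: Z_def PiE_UNIV_domain)
    have sub: "B \<subseteq> (\<Union>z\<in>c ` B. (**) (inv_into B c z) ` U)"
    proof
      fix h assume h: "h \<in> B"
      \<comment> \<open>The representative of a cell is chosen in \<open>B\<close>, not at the
        centre of the cell: it must lie in \<open>G\<close> and have entries at most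
        \<open>N\<close>.\<close>
      define g where "g = inv_into B c (c h)"
      have g: "g \<in> B" "c g = c h"
        using h unfolding g_def by (auto simp: inv_into_into f_inv_into_f)
      then have "g \<in> G" "h \<in> G" using h by (auto simp: B_def)
      obtain s where s: "s \<in> G" "g ** s = mat 1" "s ** g = mat 1"
        using unimodular_inverseE[OF \<open>g \<in> G\<close>] by blast
      have gN: "\<bar>g $ i $ j\<bar> \<le> real N" for i j
        using g(1) matrix_entry_le_norm[of g i j] by (simp add: B_def)
      have sN: "\<bar>s $ i $ j\<bar> \<le> fact n * real N ^ n" for i j
        using unimodular_inverse_entries_le[OF \<open>g \<in> G\<close> s(2) gN] N by (simp add: n_def)
      have hg: "\<bar>h $ i $ j - g $ i $ j\<bar> \<le> 1 / real M" for i j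
      proof -
        have "\<lfloor>real M * g $ i $ j\<rfloor> = \<lfloor>real M * h $ i $ j\<rfloor>"
          using fun_cong[OF g(2), of "(i, j)"] by (simp add: c_def)
        then have "\<bar>real M * h $ i $ j - real M * g $ i $ j\<bar> \<le> 1" by linarith
        then have "real M * \<bar>h $ i $ j - g $ i $ j\<bar> \<le> 1"
          by (simp add: abs_mult flip: right_diff_distrib)
        then show ?thesis
          using \<open>1 \<le> M\<close> by (simp add: field_simps)
      qed
      have "\<bar>(s ** h - mat 1) $ i $ j\<bar> \<le> 1" for i j
      proof -
        have "(s ** h - mat 1) $ i $ j = (s ** h - s ** g) $ i $ j"
          by (simp add: s)
        also have "\<dots> = (\<Sum>k\<in>UNIV. s $ i $ k * (h $ k $ j - g $ k $ j))"
          by (simp add: matrix_matrix_mult_def sum_subtractf right_diff_distrib)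
        finally have "\<bar>(s ** h - mat 1) $ i $ j\<bar> \<le> (\<Sum>k\<in>UNIV. \<bar>s $ i $ k * (h $ k $ j - g $ k $ j)\<bar>)"
          by (simp only: sum_abs)
        also have "\<dots> \<le> (\<Sum>k\<in>(UNIV :: 'n set). (fact n * real N ^ n) * (1 / real M))"
          unfolding abs_mult by (intro sum_mono mult_mono sN hg) auto
        also have "\<dots> = 1"
          using \<open>1 \<le> M\<close> N n1 by (simp add: M_def n_def[symmetric])
        finally show ?thesis .
      qed
      then have "norm (s ** h - mat 1) \<le> D"
        unfolding D_def n_def by (rule norm_matrix_le_of_entries)
      then have "s ** h \<in> U"
        using s(1) \<open>h \<in> G\<close> by (simp add: U_def unimodular_mult dist_norm norm_minus_commute)
      moreover have "h = g ** (s ** h)"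
        by (simp add: matrix_mul_assoc s)
      ultimately have "h \<in> (**) g ` U" by blast
      then show "h \<in> (\<Union>z\<in>c ` B. (**) (inv_into B c z) ` U)"
        using h unfolding g_def by blast
    qed
    have rep: "inv_into B c z \<in> G" if "z \<in> c ` B" for z
      using inv_into_into[OF that] by (simp add: B_def)
    have fin: "finite (c ` B)" using cB finZ finite_subset by blast
    have "emeasure \<nu> B \<le> emeasure \<nu> (\<Union>z\<in>c ` B. (**) (inv_into B c z) ` U)"
      using fin rep U(1) by (intro emeasure_mono sub sets.finite_UN left_mult_image_sets)
    also have "\<dots> \<le> (\<Sum>z\<in>c ` B. emeasure \<nu> ((**) (inv_into B c z) ` U))"
      using fin rep U(1) by (intro emeasure_subadditive_finite) (auto intro!: left_mult_image_sets)
    also have "\<dots> = (\<Sum>z\<in>c ` B. ennreal u)"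
      using rep U(1) u(1) by (intro sum.cong refl) (simp add: emeasure_haar_image)
    also have "\<dots> = ennreal (real (card (c ` B)) * u)"
      using u(2) by (simp add: ennreal_mult ennreal_of_nat_eq_real_of_nat)
    also have "\<dots> \<le> ennreal (C * real N ^ p)"
    proof (rule ennreal_leI)
      have "real (card (c ` B)) \<le> real (card Z)"
        using card_mono[OF finZ cB] by simp
      also have "\<dots> = real (2 * (M * N) + 1) ^ (n * n)"
        by (simp add: cardZ)
      also have "\<dots> \<le> real (3 * n * fact n * N ^ Suc n) ^ (n * n)"
      proof (intro power_mono of_nat_mono)
        have "1 \<le> M * N" using \<open>1 \<le> M\<close> N by simp
        then have "2 * (M * N) + 1 \<le> 3 * (M * N)" by linarith
        then show "2 * (M * N) + 1 \<le> 3 * n * fact n * N ^ Suc n"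
          by (simp add: M_def algebra_simps)
      qed simp
      also have "\<dots> = (3 * real n * fact n) ^ (n * n) * real N ^ p"
        by (simp add: p_def power_mult_distrib power_add flip: power_mult)
      finally show "real (card (c ` B)) * u \<le> C * real N ^ p"
        using u(2) mult_right_mono by (fastforce simp: C_def algebra_simps)
    qed
    finally show ?thesis unfolding B_def .
  qed
  moreover have "0 \<le> C" by (simp add: C_def u(2))
  ultimately show thesis using that by blast
qed

text \<open>The point \<open>r\<close> is charged to the ball of radius \<open>Suc N\<close> with
  \<open>N = nat \<lfloor>norm r\<rfloor>\<close>. Whole balls instead of shells do no harm, because
  \<open>q = p + 2\<close> exceeds the growth exponent by 2 and leaves the convergent series of
  inverse squares.\<close>

lemma nn_integral_haar_power_finite:
  obtains q :: nat where "(\<integral>\<^sup>+r. ennreal (inverse (1 + norm r) ^ q) \<partial>\<nu>) < \<infinity>"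
proof -
  obtain C p where C: "0 \<le> C"
    "\<And>N :: nat. 1 \<le> N \<Longrightarrow> emeasure \<nu> {r \<in> G. norm r \<le> real N} \<le> ennreal (C * real N ^ p)"
    using emeasure_haar_growth by blast
  define q where "q = p + 2"
  define f where "f = (\<lambda>(N :: nat) r. ennreal (inverse (real (Suc N)) ^ q) * indicator {r \<in> G. norm r \<le> real (Suc N)} r)"
  have sets: "{r \<in> G. norm r \<le> R} \<in> sets \<nu>" for R
  proof -
    have "{r \<in> G. norm r \<le> R} = G \<inter> cball 0 R" by auto
    then show ?thesis by (auto simp: sets_haar_iff closed_unimodular_matrices)
  qed
  have "(\<integral>\<^sup>+r. ennreal (inverse (1 + norm r) ^ q) \<partial>\<nu>) \<le> (\<integral>\<^sup>+r. (\<Sum>N. f N r) \<partial>\<nu>)"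
  proof (rule nn_integral_mono)
    fix r assume "r \<in> space \<nu>"
    then have "r \<in> G" by (simp add: space_haar)
    define N where "N = nat \<lfloor>norm r\<rfloor>"
    have N: "real N \<le> norm r" "norm r \<le> real (Suc N)"
      unfolding N_def by (auto simp: of_nat_nat) linarith
    have "ennreal (inverse (1 + norm r) ^ q) \<le> ennreal (inverse (real (Suc N)) ^ q)"
      using N by (intro ennreal_leI power_mono le_imp_inverse_le) auto
    also have "\<dots> = f N r"
      using N \<open>r \<in> G\<close> by (simp add: f_def)
    also have "\<dots> \<le> (\<Sum>N. f N r)"
      using sum_le_suminf[of "\<lambda>N. f N r" "{N}"] by simp
    finally show "ennreal (inverse (1 + norm r) ^ q) \<le> (\<Sum>N. f N r)" .
  qed
  also have "\<dots> = (\<Sum>N. \<integral>\<^sup>+r. f N r \<partial>\<nu>)"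
    unfolding f_def
    by (intro nn_integral_suminf borel_measurable_times_ennreal borel_measurable_indicator sets) auto
  also have "\<dots> = (\<Sum>N. ennreal (inverse (real (Suc N)) ^ q) * emeasure \<nu> {r \<in> G. norm r \<le> real (Suc N)})"
    unfolding f_def using sets by (subst nn_integral_cmult_indicator) auto
  also have "\<dots> \<le> (\<Sum>N. ennreal (C * inverse (real (Suc N)) ^ 2))"
  proof (intro suminf_le summableI)
    fix N
    have "ennreal (inverse (real (Suc N)) ^ q) * emeasure \<nu> {r \<in> G. norm r \<le> real (Suc N)}
        \<le> ennreal (inverse (real (Suc N)) ^ q) * ennreal (C * real (Suc N) ^ p)"
      by (intro mult_left_mono C(2)) auto
    also have "\<dots> = ennreal (C * inverse (real (Suc N)) ^ 2)"
      using C(1) by (simp add: q_def power_add power2_eq_square field_simps flip: ennreal_mult del: of_nat_Suc)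
    finally show "ennreal (inverse (real (Suc N)) ^ q) * emeasure \<nu> {r \<in> G. norm r \<le> real (Suc N)}
        \<le> ennreal (C * inverse (real (Suc N)) ^ 2)" .
  qed
  also have "\<dots> < \<infinity>"
  proof -
    have "summable (\<lambda>N. inverse (real N) ^ 2)"
      using inverse_power_summable[of 2] by (simp add: power_inverse)
    then have "summable (\<lambda>N. C * inverse (real (Suc N)) ^ 2)"
      by (intro summable_mult) (subst summable_Suc_iff)
    then have "(\<Sum>N. ennreal (C * inverse (real (Suc N)) ^ 2)) \<noteq> top"
      using C(1) by (intro ennreal_suminf_neq_top) auto
    then show ?thesis by (simp add: less_top)
  qed
  finally show thesis using that by blast
qed

end

section \<open>Hausdorff convergence and overlaps\<close>

text \<open>Compactness bounds the families under \<open>SUP\<close>, so that the suprema are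
  genuine.\<close>

lemma infdist_le_hausdorff_dist:
  fixes K L :: "'a::heine_borel set"
  assumes "compact K" "compact L"
  shows "x \<in> K \<Longrightarrow> infdist x L \<le> hausdorff_dist K L"
    and "y \<in> L \<Longrightarrow> infdist y K \<le> hausdorff_dist K L"
proof -
  have bdd: "bdd_above ((\<lambda>x. infdist x B) ` A)" if "compact A" for A B :: "'a set"
    by (intro compact_imp_bounded bounded_imp_bdd_above compact_continuous_image that continuous_intros)
  show "infdist x L \<le> hausdorff_dist K L" if "x \<in> K"
    unfolding hausdorff_dist_def using cSUP_upper[OF that bdd[OF assms(1)], of L] by simp
  show "infdist y K \<le> hausdorff_dist K L" if "y \<in> L"
    unfolding hausdorff_dist_def using cSUP_upper[OF that bdd[OF assms(2)], of K] by simp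
qed

lemma convex_body_nonempty: "convex_body L \<Longrightarrow> L \<noteq> {}"
  by (auto simp: convex_body_def)

lemma convex_body_measure_pos: "convex_body L \<Longrightarrow> measure lebesgue L > 0"
  unfolding convex_body_def
  by (metis lmeasurable_compact measure_lebesgue_affine negligible_convex_interior
      negligible_iff_measure measure_nonneg order_le_imp_less_or_eq)

text \<open>The witness is \<open>x\<close> pushed away from its nearest point in \<open>L\<close>.\<close>

lemma infdist_push_away:
  fixes L :: "'a::euclidean_space set"
  assumes "convex L" "closed L" "L \<noteq> {}" "x \<notin> L" "0 \<le> e"
  obtains y where "dist y x = e" "e < infdist y L"
proof -
  define p where "p = closest_point L x"
  have pL: "p \<in> L" using closest_point_in_set[OF assms(2,3)] by (simp add: p_def)
  then have "x \<noteq> p" using assms(4) by auto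
  define d where "d = norm (x - p)"
  have d: "d > 0" using \<open>x \<noteq> p\<close> by (simp add: d_def)
  define u where "u = (x - p) /\<^sub>R d"
  have u: "norm u = 1" "u \<bullet> (x - p) = d"
    using d by (simp_all add: u_def d_def dot_square_norm power2_eq_square)
  define y where "y = x + e *\<^sub>R u"
  have "d + e \<le> dist y z" if "z \<in> L" for z
  proof -
    \<comment> \<open>The hyperplane through the nearest point \<open>p\<close> orthogonal to
      \<open>x - p\<close> has all of \<open>L\<close> on its far side, so a step of length
      \<open>e\<close> along \<open>u\<close> adds \<open>e\<close> to the lower bound for the
      distance to every point of \<open>L\<close>.\<close>
    have "(x - p) \<bullet> (z - p) \<le> 0"
      unfolding p_def by (rule closest_point_dot) (use assms that in auto)
    then have "u \<bullet> (z - p) \<le> 0"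
      using d by (simp add: u_def mult_nonneg_nonpos)
    have "y - z = (x - p) + e *\<^sub>R u - (z - p)" by (simp add: y_def)
    then have "u \<bullet> (y - z) = d + e * (u \<bullet> u) - u \<bullet> (z - p)"
      by (simp only: inner_diff_right[of u "_ + _"] inner_add_right inner_scaleR_right u(2))
    also have "\<dots> \<ge> d + e"
      using u(1) \<open>u \<bullet> (z - p) \<le> 0\<close> by (simp add: dot_square_norm)
    finally show ?thesis
      using norm_cauchy_schwarz[of u "y - z"] u(1) by (simp add: dist_norm)
  qed
  then have "d + e \<le> infdist y L"
    using assms(3) by (simp add: infdist_def cINF_greatest)
  with d have "e < infdist y L" by linarith
  moreover have "dist y x = e"
    using assms(5) u(1) by (simp add: y_def dist_norm)
  ultimately show thesis using that by blast
qed

text \<open>For \<open>x\<close> outside \<open>L\<close>, its positive distance to \<open>L\<close>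
  decides. For interior \<open>x\<close>, convexity of \<open>M j\<close> rules out holes: if
  \<open>M j\<close> missed \<open>X j\<close>, pushing \<open>X j\<close> away from
  \<open>M j\<close> would end at a point of \<open>L\<close> too far from \<open>M j\<close>. The
  tested point moves with \<open>j\<close> because it is later rescaled by
  \<open>vol_root (M j)\<close>.\<close>

lemma eventually_mem_iff_of_hausdorff_tendsto:
  fixes L :: "(real ^ 'n) set"
  assumes L: "convex_body L" and Lj: "\<And>j. convex_body (M j)"
    and lim: "(\<lambda>j. hausdorff_dist L (M j)) \<longlonglongrightarrow> 0"
    and x: "x \<notin> frontier L" and xj: "X \<longlonglongrightarrow> x"
  shows "\<forall>\<^sub>F j in sequentially. X j \<in> M j \<longleftrightarrow> x \<in> L"
proof (cases "x \<in> L")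
  case False
  define \<delta> where "\<delta> = infdist x L"
  have "\<delta> > 0"
    using L False infdist_pos_not_in_closed[of L x] convex_body_nonempty[OF L]
    by (simp add: \<delta>_def convex_body_def compact_imp_closed)
  have "\<forall>\<^sub>F j in sequentially. hausdorff_dist L (M j) < \<delta> / 2"
    using order_tendstoD(2)[OF lim, of "\<delta> / 2"] \<open>\<delta> > 0\<close> by simp
  moreover have "\<forall>\<^sub>F j in sequentially. dist (X j) x < \<delta> / 2"
    using tendstoD[OF xj, of "\<delta> / 2"] \<open>\<delta> > 0\<close> by simp
  ultimately show ?thesis
  proof eventually_elim
    case (elim j)
    have "X j \<notin> M j"
    proof
      assume "X j \<in> M j"
      then have "infdist (X j) L \<le> hausdorff_dist L (M j)"
        using L Lj by (intro infdist_le_hausdorff_dist) (auto simp: convex_body_def)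
      then show False
        using infdist_triangle[of x L "X j"] elim by (simp add: \<delta>_def dist_commute)
    qed
    then show ?case using False by simp
  qed
next
  case True
  with x have "x \<in> interior L"
    by (metis Diff_iff closure_subset frontier_def subsetD)
  then obtain e where e: "e > 0" "cball x e \<subseteq> L"
    by (meson interior_subset mem_interior_cball)
  have "\<forall>\<^sub>F j in sequentially. hausdorff_dist L (M j) < e / 2"
    using order_tendstoD(2)[OF lim, of "e / 2"] \<open>e > 0\<close> by simp
  moreover have "\<forall>\<^sub>F j in sequentially. dist (X j) x < e / 2"
    using tendstoD[OF xj, of "e / 2"] \<open>e > 0\<close> by simp
  ultimately show ?thesis
  proof eventually_elim
    case (elim j)
    have "X j \<in> M j"
    proof (rule ccontr)
      assume "X j \<notin> M j"
      then obtain y where y: "dist y (X j) = e / 2" "e / 2 < infdist y (M j)"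
        using infdist_push_away[of "M j" "X j" "e / 2"] Lj[of j] convex_body_nonempty[OF Lj[of j]] e(1)
        by (auto simp: convex_body_def compact_imp_closed)
      have "dist x y \<le> e"
        using dist_triangle[of x y "X j"] y(1) elim by (simp add: dist_commute)
      then have "y \<in> L" using e(2) by auto
      then have "infdist y (M j) \<le> hausdorff_dist L (M j)"
        using L Lj by (intro infdist_le_hausdorff_dist) (auto simp: convex_body_def)
      with y elim show False by simp
    qed
    then show ?case using True by simp
  qed
qed

lemma eventually_mem_iff_of_notin_frontier:
  assumes "closed L" "x \<notin> frontier L" "X \<longlonglongrightarrow> x"
  shows "\<forall>\<^sub>F j in sequentially. X j \<in> L \<longleftrightarrow> x \<in> L"
proof (cases "x \<in> L")
  case True
  with assms(2) have "x \<in> interior L"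
    by (metis Diff_iff closure_subset frontier_def subsetD)
  then have "\<forall>\<^sub>F j in sequentially. X j \<in> interior L"
    using assms(3) topological_tendstoD by blast
  then show ?thesis
    by eventually_elim (use True interior_subset in auto)
next
  case False
  then have "\<forall>\<^sub>F j in sequentially. X j \<in> - L"
    using assms(1,3) topological_tendstoD[of X x sequentially "- L"] by auto
  then show ?thesis
    by eventually_elim (use False in auto)
qed

lemma overlap_set_lmeasurable:
  assumes "compact K" "closed M"
  shows "aff \<phi> -` M \<inter> K \<in> lmeasurable"
  using closed_Int_compact[OF closed_aff_vimage[OF assms(2)] assms(1)] lmeasurable_compact by blast

lemma overlap_nonneg: "0 \<le> overlap K L \<phi>"
  by (simp add: overlap_def)

lemma overlap_le_measure:
  assumes "compact K" "closed M"
  shows "overlap K M \<phi> \<le> measure lebesgue K"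
  unfolding overlap_def using assms
  by (intro measure_mono_fmeasurable lmeasurable_compact) (auto intro: fmeasurableD overlap_set_lmeasurable)

text \<open>Dominated convergence with majorant the indicator of \<open>K\<close>, phrased so that
  both the map and the body may vary. Membership may fail to converge only on \<open>Z\<close>,
  whose preimage under the invertible limit map is still null.\<close>

lemma overlap_tendsto:
  fixes K :: "(real ^ 'n) set"
  assumes K: "compact K" and M: "closed M" "\<And>j. closed (N j)"
    and Z: "negligible Z" and \<phi>: "invertible (fst \<phi>)" "\<Phi> \<longlonglongrightarrow> \<phi>"
    and ev: "\<And>y Y. y \<notin> Z \<Longrightarrow> Y \<longlonglongrightarrow> y \<Longrightarrow> \<forall>\<^sub>F j in sequentially. Y j \<in> N j \<longleftrightarrow> y \<in> M"
  shows "(\<lambda>j. overlap K (N j) (\<Phi> j)) \<longlonglongrightarrow> overlap K M \<phi>"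
proof -
  have eq: "overlap K A \<psi> = (\<integral>a. indicator (aff \<psi> -` A \<inter> K) a \<partial>lebesgue)" for A :: "(real ^ 'n) set" and \<psi>
    by (simp add: overlap_def)
  show ?thesis
    unfolding eq
  proof (rule integral_dominated_convergence)
    show "indicat_real (aff \<phi> -` M \<inter> K) \<in> borel_measurable lebesgue"
      "indicat_real (aff (\<Phi> j) -` N j \<inter> K) \<in> borel_measurable lebesgue" for j
      by (intro borel_measurable_indicator fmeasurableD overlap_set_lmeasurable K M)+
    show "integrable lebesgue (indicat_real K)"
      using lmeasurable_compact[OF K] by (auto simp: fmeasurable_def intro: integrable_real_indicator)
    show "AE a in lebesgue. norm (indicat_real (aff (\<Phi> j) -` N j \<inter> K) a) \<le> indicat_real K a" for j
      by (auto simp: indicator_def)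
    have "aff \<phi> -` Z \<in> null_sets lebesgue"
      using negligible_aff_vimage[OF \<phi>(1) Z] by (simp add: negligible_iff_null_sets)
    then have "AE a in lebesgue. aff \<phi> a \<notin> Z"
      using AE_not_in by fastforce
    then show "AE a in lebesgue. (\<lambda>j. indicat_real (aff (\<Phi> j) -` N j \<inter> K) a)
        \<longlonglongrightarrow> indicat_real (aff \<phi> -` M \<inter> K) a"
    proof eventually_elim
      case (elim a)
      have "(\<lambda>j. aff (\<Phi> j) a) \<longlonglongrightarrow> aff \<phi> a"
        by (intro tendsto_intros \<phi>(2))
      from ev[OF elim this] have "\<forall>\<^sub>F j in sequentially.
          indicat_real (aff (\<Phi> j) -` N j \<inter> K) a = indicat_real (aff \<phi> -` M \<inter> K) a"
        by eventually_elim (simp add: indicator_def)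
      then show ?case
        by (rule tendsto_eventually)
    qed
  qed
qed

section \<open>Integrability of powers of the overlap\<close>

text \<open>A nonzero overlap provides a point of \<open>K\<close> sent into \<open>L\<close>; the
  translation part is its image minus its image under the linear part.\<close>

lemma overlap_support:
  assumes "K \<subseteq> cball 0 \<rho>" "L \<subseteq> cball 0 \<rho>" "overlap K L \<phi> \<noteq> 0"
  shows "norm (snd \<phi>) \<le> \<rho> * (1 + norm (fst \<phi>))"
proof -
  have "aff \<phi> -` L \<inter> K \<noteq> {}"
    using assms(3) by (auto simp: overlap_def)
  then obtain a where a: "a \<in> K" "aff \<phi> a \<in> L" by auto
  then have n: "norm a \<le> \<rho>" "norm (aff \<phi> a) \<le> \<rho>" using assms(1,2) by auto
  have "norm (snd \<phi>) \<le> norm (aff \<phi> a) + norm (fst \<phi> *v a)"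
    using norm_triangle_ineq4[of "aff \<phi> a" "fst \<phi> *v a"] by (simp add: aff_def)
  also have "norm (fst \<phi> *v a) \<le> norm (fst \<phi>) * \<rho>"
    using norm_matrix_vector_mult_le[of "fst \<phi>" a] mult_left_mono[OF n(1), of "norm (fst \<phi>)"] by simp
  finally show ?thesis
    using n(2) by (simp add: algebra_simps)
qed

lemma content_cube:
  fixes c :: "real ^ 'n"
  assumes "0 \<le> R"
  shows "measure lborel (cbox (c - (\<chi> k. R)) (c + (\<chi> k. R))) = (2 * R) ^ CARD('n)"
proof -
  have "c \<in> cbox (c - (\<chi> k. R)) (c + (\<chi> k. R))"
    using assms by (simp add: mem_box_cart)
  then have "cbox (c - (\<chi> k. R)) (c + (\<chi> k. R)) \<noteq> {}" by blast
  then show ?thesis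
    by (simp add: content_cbox_cart)
qed

text \<open>
  Replacing the \<open>j\<close>-th coordinate of \<open>a\<close> by the \<open>i\<close>-th coordinate of \<open>r a\<close> scales volumes by
  \<open>r\<^sub>i\<^sub>j\<close> and maps \<open>\<phi>\<^sup>-\<^sup>1(L) \<inter> K\<close> into a cube of side \<open>2\<rho>\<close>.
\<close>

lemma overlap_entry_decay:
  fixes K L :: "(real ^ 'n) set"
  assumes "compact K" "closed L" "K \<subseteq> cball 0 \<rho>" "L \<subseteq> cball 0 \<rho>" "0 \<le> \<rho>"
  shows "\<bar>r $ i $ j\<bar> * overlap K L (r, x) \<le> (2 * \<rho>) ^ CARD('n)"
proof -
  define A where "A = aff (r, x) -` L \<inter> K"
  have A: "A \<in> lmeasurable"
    unfolding A_def by (intro overlap_set_lmeasurable assms)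
  define f where "f = (\<lambda>a. \<chi> k. if k = j then (r *v a) $ i else a $ k)"
  have lin: "linear f"
    by (rule linearI)
      (auto simp: f_def vec_eq_iff matrix_vector_right_distrib matrix_vector_mult_scaleR)
  have "matrix f = (\<chi> k. if k = j then \<Sum>l\<in>UNIV. r $ i $ l *s row l (mat 1) else row k (mat 1))"
    by (auto simp: matrix_def f_def vec_eq_iff row_def mat_def axis_def matrix_vector_mult_def
        if_distrib[of "\<lambda>x. _ * x"] sum.delta cong: if_cong)
  then have det: "det (matrix f) = r $ i $ j"
    using cramer_lemma_transpose[where k = j and x = "r $ i" and A = "mat 1 :: real ^ 'n ^ 'n"] by simp
  \<comment> \<open>What is bounded on \<open>A\<close> is the \<open>i\<close>-th coordinate of
    \<open>r *v a + x\<close>, whereas \<open>f\<close> uses that of \<open>r *v a\<close>.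
    Recentring by \<open>- x $ i\<close> makes the volume bound independent of
    \<open>x\<close>.\<close>
  define c where "c = (\<chi> k. if k = j then - x $ i else (0 :: real))"
  let ?R = "(\<chi> k. \<rho>) :: real ^ 'n"
  have fA: "f ` A \<subseteq> cbox (c - ?R) (c + ?R)"
  proof (intro image_subsetI)
    fix a assume "a \<in> A"
    then have "norm a \<le> \<rho>" "norm (r *v a + x) \<le> \<rho>"
      using assms(3,4) by (auto simp: A_def aff_def)
    then have "\<bar>a $ k\<bar> \<le> \<rho>" "\<bar>(r *v a) $ i + x $ i\<bar> \<le> \<rho>" for k
      using component_le_norm_cart[of a k] component_le_norm_cart[of "r *v a + x" i] by auto
    note b = this
    have "c $ k - \<rho> \<le> f a $ k \<and> f a $ k \<le> c $ k + \<rho>" for k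
    proof (cases "k = j")
      case True
      then show ?thesis using b(2) by (simp add: f_def c_def abs_le_iff)
    next
      case False
      then show ?thesis using b(1)[of k] by (simp add: f_def c_def abs_le_iff)
    qed
    then show "f a \<in> cbox (c - ?R) (c + ?R)"
      by (simp add: mem_box_cart)
  qed
  have "\<bar>r $ i $ j\<bar> * overlap K L (r, x) = measure lebesgue (f ` A)"
    using measure_linear_image_det[OF lin A] by (simp add: det overlap_def A_def)
  also have "\<dots> \<le> measure lebesgue (cbox (c - ?R) (c + ?R))"
    by (intro measure_mono_fmeasurable fA fmeasurableD lmeasurable_linear_image lin A) simp
  also have "\<dots> = (2 * \<rho>) ^ CARD('n)"
    using content_cube[OF assms(5)] by simp
  finally show ?thesis .
qed

text \<open>The volume of \<open>K\<close> pays for the summand 1 and the entry estimate, taken over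
  all entries, for \<open>norm (fst \<phi>)\<close>. The constant sees \<open>L\<close> only through
  the radius \<open>\<rho>\<close>.\<close>

lemma overlap_decay:
  fixes K L :: "(real ^ 'n) set"
  assumes "compact K"
  obtains C where "0 \<le> C"
    "\<And>L \<phi>. closed L \<Longrightarrow> L \<subseteq> cball 0 \<rho> \<Longrightarrow> overlap K L \<phi> * (1 + norm (fst \<phi>)) \<le> C"
proof -
  obtain \<rho>' where "K \<subseteq> ball 0 \<rho>'"
    using bounded_subset_ballD[OF compact_imp_bounded[OF assms]] by blast
  then have \<rho>': "K \<subseteq> cball 0 \<rho>'"
    using ball_subset_cball by blast
  define R where "R = max 0 (max \<rho> \<rho>')"
  define C where "C = measure lebesgue K + real CARD('n) * (real CARD('n) * (2 * R) ^ CARD('n))"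
  have R0: "0 \<le> R" by (simp add: R_def)
  then have "0 \<le> C" by (simp add: C_def)
  moreover have "overlap K L \<phi> * (1 + norm (fst \<phi>)) \<le> C"
    if L: "closed L" "L \<subseteq> cball 0 \<rho>" for L \<phi>
  proof -
    obtain r x where \<phi>: "\<phi> = (r, x)" by (cases \<phi>)
    have sub: "K \<subseteq> cball 0 R" "L \<subseteq> cball 0 R"
      using L(2) \<rho>' unfolding R_def by (auto simp: subset_iff)
    have "norm (overlap K L \<phi> *\<^sub>R r) \<le> real CARD('n) * (real CARD('n) * (2 * R) ^ CARD('n))"
      using overlap_entry_decay[OF assms L(1) sub R0, of r _ _ x] overlap_nonneg[of K L \<phi>]
      by (intro norm_matrix_le_of_entries) (simp add: \<phi> abs_mult mult.commute)
    then have "overlap K L \<phi> * norm r \<le> real CARD('n) * (real CARD('n) * (2 * R) ^ CARD('n))"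
      using overlap_nonneg[of K L \<phi>] by simp
    then show ?thesis
      using overlap_le_measure[OF assms L(1), of \<phi>] by (simp add: C_def \<phi> algebra_simps)
  qed
  ultimately show thesis using that by blast
qed

text \<open>The frontier of a convex set is null, so \<open>overlap_tendsto\<close> applies with a
  constant body. Continuity is also the source of measurability on the product space.\<close>

lemma continuous_on_overlap:
  fixes K L :: "(real ^ 'n) set"
  assumes "compact K" "convex_body L"
  shows "continuous_on (unimodular_matrices \<times> UNIV) (overlap K L)"
  unfolding continuous_on_sequentially
proof (intro allI ballI impI)
  fix \<Phi> :: "nat \<Rightarrow> (real ^ 'n ^ 'n) \<times> (real ^ 'n)" and \<phi>
  assume \<phi>: "\<phi> \<in> unimodular_matrices \<times> UNIV"
    and "(\<forall>n. \<Phi> n \<in> unimodular_matrices \<times> UNIV) \<and> \<Phi> \<longlonglongrightarrow> \<phi>"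
  then have lim: "\<Phi> \<longlonglongrightarrow> \<phi>" by blast
  have L: "closed L" "negligible (frontier L)"
    using assms(2) by (auto simp: convex_body_def compact_imp_closed negligible_convex_frontier)
  have "invertible (fst \<phi>)" using \<phi> by (auto simp: unimodular_invertible)
  then show "(overlap K L \<circ> \<Phi>) \<longlonglongrightarrow> overlap K L \<phi>"
    unfolding o_def using lim L assms(1)
    by (intro overlap_tendsto[where Z = "frontier L"] eventually_mem_iff_of_notin_frontier)
qed

context unimodular_haar
begin

abbreviation (input) P :: "((real ^ 'n ^ 'n) \<times> (real ^ 'n)) measure" where "P \<equiv> saff_measure \<nu>"

lemma space_saff: "space P = G \<times> UNIV"
  by (simp add: saff_measure_def space_pair_measure space_haar)

lemma borel_measurable_saff:
  fixes f :: "(real ^ 'n ^ 'n) \<times> (real ^ 'n) \<Rightarrow> 'b::topological_space"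
  assumes "continuous_on (G \<times> UNIV) f"
  shows "f \<in> borel_measurable P"
proof -
  have "(\<lambda>\<phi>. (fst \<phi>, snd \<phi>)) \<in> measurable P borel"
    unfolding saff_measure_def borel_prod[symmetric] by measurable
  then have "(\<lambda>\<phi>. \<phi>) \<in> measurable P (restrict_space borel (G \<times> UNIV))"
    by (intro measurable_restrict_space2) (auto simp: space_saff)
  from measurable_compose[OF this borel_measurable_continuous_on_restrict[OF assms]]
  show ?thesis .
qed

lemma borel_measurable_overlap:
  "compact K \<Longrightarrow> convex_body L \<Longrightarrow> overlap K L \<in> borel_measurable P"
  by (intro borel_measurable_saff continuous_on_overlap)

lemma borel_measurable_aff_saff: "(\<lambda>\<phi>. aff \<phi> v) \<in> borel_measurable P"
  by (intro borel_measurable_saff continuous_intros)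

text \<open>The common majorant of both integrands of \<open>T_unit\<close>: the power comes from
  the decay of the overlap, the extra factor \<open>1 + norm (fst \<phi>)\<close> from the growth of
  \<open>aff \<phi> v\<close>, the indicator from the support condition.\<close>

lemma weight_integrable:
  obtains k0 where "1 \<le> k0" "\<And>k \<rho>. k0 \<le> k \<Longrightarrow> 0 \<le> \<rho> \<Longrightarrow>
    integrable P (\<lambda>\<phi>. inverse (1 + norm (fst \<phi>)) ^ k * (1 + norm (fst \<phi>)) *
      indicator {\<phi>. norm (snd \<phi>) \<le> \<rho> * (1 + norm (fst \<phi>))} \<phi>)"
proof -
  obtain q where q: "(\<integral>\<^sup>+r. ennreal (inverse (1 + norm r) ^ q) \<partial>\<nu>) < \<infinity>"
    using nn_integral_haar_power_finite by blast
  define n where "n = CARD('n)"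
  \<comment> \<open>Integrating out the translation costs the power \<open>n\<close> (volume of a
    ball of radius proportional to \<open>1 + norm r\<close>), the extra factor costs 1, and
    \<open>q\<close> remains for the Haar integral.\<close>
  define k0 where "k0 = q + n + 1"
  have "integrable P (\<lambda>\<phi>. inverse (1 + norm (fst \<phi>)) ^ k * (1 + norm (fst \<phi>)) *
      indicator {\<phi>. norm (snd \<phi>) \<le> \<rho> * (1 + norm (fst \<phi>))} \<phi>)"
    (is "integrable P ?W") if k: "k0 \<le> k" and \<rho>: "0 \<le> \<rho>" for k \<rho>
  proof (rule integrableI_nonneg)
    have cont: "continuous_on (G \<times> UNIV) (\<lambda>\<phi> :: (real ^ 'n ^ 'n) \<times> (real ^ 'n).
        inverse (1 + norm (fst \<phi>)) ^ k * (1 + norm (fst \<phi>)))"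
      by (intro continuous_intros) (use add_pos_nonneg[OF zero_less_one norm_ge_zero] in \<open>metis less_irrefl\<close>)
    have "(\<lambda>\<phi>. norm (snd \<phi>) - \<rho> * (1 + norm (fst \<phi>))) \<in> borel_measurable P"
      by (intro borel_measurable_saff continuous_intros)
    from measurable_sets[OF this, of "{..0}"]
    have "{\<phi> \<in> space P. norm (snd \<phi>) \<le> \<rho> * (1 + norm (fst \<phi>))} \<in> sets P"
      by (simp add: vimage_def Int_def conj_commute)
    then have "indicat_real {\<phi>. norm (snd \<phi>) \<le> \<rho> * (1 + norm (fst \<phi>))} \<in> borel_measurable P"
      by (subst borel_measurable_indicator_iff) (simp add: Int_def conj_commute)
    with borel_measurable_saff[OF cont] show meas: "?W \<in> borel_measurable P"
      by (rule borel_measurable_times)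
    show "AE \<phi> in P. 0 \<le> ?W \<phi>" by simp
    have "(\<integral>\<^sup>+\<phi>. ennreal (?W \<phi>) \<partial>P) = (\<integral>\<^sup>+r. \<integral>\<^sup>+x. ennreal (?W (r, x)) \<partial>lborel \<partial>\<nu>)"
      unfolding saff_measure_def
      by (rule lborel.nn_integral_fst[symmetric]) (use meas in \<open>auto simp: saff_measure_def\<close>)
    also have "\<dots> \<le> (\<integral>\<^sup>+r. ennreal ((2 * \<rho>) ^ n) * ennreal (inverse (1 + norm r) ^ q) \<partial>\<nu>)"
    proof (rule nn_integral_mono)
      fix r :: "real ^ 'n ^ 'n"
      define w where "w = 1 + norm r"
      have w: "1 \<le> w" by (simp add: w_def)
      have "(\<integral>\<^sup>+x. ennreal (?W (r, x)) \<partial>lborel) =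
          (\<integral>\<^sup>+x. ennreal (inverse w ^ k * w) * indicator (cball (0 :: real ^ 'n) (\<rho> * w)) x \<partial>lborel)"
        by (intro nn_integral_cong) (simp add: w_def indicator_def)
      also have "\<dots> = ennreal (inverse w ^ k * w) * emeasure lborel (cball (0 :: real ^ 'n) (\<rho> * w))"
        by (subst nn_integral_cmult_indicator) auto
      also have "emeasure lborel (cball (0 :: real ^ 'n) (\<rho> * w)) \<le>
          emeasure lborel (cbox (0 - (\<chi> i. \<rho> * w)) (0 + (\<chi> i. \<rho> * w)) :: (real ^ 'n) set)"
      proof (intro emeasure_mono subsetI)
        fix x :: "real ^ 'n"
        assume "x \<in> cball 0 (\<rho> * w)"
        then have "\<bar>x $ i\<bar> \<le> \<rho> * w" for i
          using component_le_norm_cart[of x i] by simp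
        then show "x \<in> cbox (0 - (\<chi> i. \<rho> * w)) (0 + (\<chi> i. \<rho> * w))"
          by (simp add: mem_box_cart abs_le_iff minus_le_iff)
      qed simp
      also have "\<dots> = ennreal ((2 * \<rho> * w) ^ n)"
        using content_cube[of "\<rho> * w" "0 :: real ^ 'n"] \<rho> w emeasure_lborel_cbox_finite
        by (subst emeasure_eq_ennreal_measure) (auto simp: n_def less_top mult.assoc)
      also have "ennreal (inverse w ^ k * w) * ennreal ((2 * \<rho> * w) ^ n) =
          ennreal ((2 * \<rho>) ^ n * (inverse w ^ k * w ^ (n + 1)))"
        using \<rho> w by (simp add: ennreal_mult[symmetric] power_mult_distrib algebra_simps)
      also have "\<dots> \<le> ennreal ((2 * \<rho>) ^ n * inverse w ^ q)"
      proof (intro ennreal_leI mult_left_mono)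
        have "inverse w ^ k * w ^ (n + 1) \<le> inverse w ^ k0 * w ^ (n + 1)"
          using k w by (intro mult_right_mono power_decreasing) (auto simp: inverse_le_1_iff)
        also have "\<dots> = inverse w ^ q"
          using w by (simp add: k0_def power_add field_simps)
        finally show "inverse w ^ k * w ^ (n + 1) \<le> inverse w ^ q" .
      qed (use \<rho> in simp)
      also have "\<dots> = ennreal ((2 * \<rho>) ^ n) * ennreal (inverse (1 + norm r) ^ q)"
        using \<rho> by (simp add: ennreal_mult w_def)
      finally show "(\<integral>\<^sup>+x. ennreal (?W (r, x)) \<partial>lborel) \<le> \<dots>"
        by (simp add: mult_left_mono)
    qed
    also have "\<dots> = ennreal ((2 * \<rho>) ^ n) * (\<integral>\<^sup>+r. ennreal (inverse (1 + norm r) ^ q) \<partial>\<nu>)"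
      by (rule nn_integral_cmult) measurable
    also have "\<dots> < \<infinity>"
      using q by (simp add: ennreal_mult_less_top)
    finally show "(\<integral>\<^sup>+\<phi>. ennreal (?W \<phi>) \<partial>P) < \<infinity>" .
  qed
  moreover have "1 \<le> k0" by (simp add: k0_def)
  ultimately show thesis using that by blast
qed

text \<open>\<open>K\<close>, \<open>L\<close> and \<open>v\<close> enter only through
  multiplicative constants and the radius \<open>\<rho>\<close>; the exponent comes from the weight
  alone and so serves all \<open>L\<close> and \<open>v\<close>.\<close>

lemma T_unit_defined_of_large_power:
  assumes K: "compact K"
  obtains k0 where "1 \<le> k0" "\<And>k L v. k0 \<le> k \<Longrightarrow> convex_body L \<Longrightarrow> T_unit_defined \<nu> k K v L"
proof -
  obtain k0 where k0: "1 \<le> k0" "\<And>k \<rho>. k0 \<le> k \<Longrightarrow> 0 \<le> \<rho> \<Longrightarrow>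
    integrable P (\<lambda>\<phi>. inverse (1 + norm (fst \<phi>)) ^ k * (1 + norm (fst \<phi>)) *
      indicator {\<phi>. norm (snd \<phi>) \<le> \<rho> * (1 + norm (fst \<phi>))} \<phi>)"
    using weight_integrable by blast
  have "T_unit_defined \<nu> k K v L" if k: "k0 \<le> k" and L: "convex_body L" for k L v
  proof -
    have "bounded (K \<union> L)"
      using K L by (auto simp: convex_body_def compact_imp_bounded)
    then obtain \<rho> where "0 < \<rho>" "K \<union> L \<subseteq> ball 0 \<rho>"
      using bounded_subset_ballD by blast
    then have \<rho>: "0 < \<rho>" "K \<subseteq> cball 0 \<rho>" "L \<subseteq> cball 0 \<rho>"
      using ball_subset_cball by auto
    have "closed L" using L by (auto simp: convex_body_def compact_imp_closed)
    obtain C where C: "0 \<le> C" "\<And>\<phi>. overlap K L \<phi> * (1 + norm (fst \<phi>)) \<le> C"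
      using overlap_decay[OF K, of \<rho>] \<open>closed L\<close> \<rho>(3) by metis
    define W where "W = (\<lambda>\<phi> :: (real ^ 'n ^ 'n) \<times> (real ^ 'n).
      inverse (1 + norm (fst \<phi>)) ^ k * (1 + norm (fst \<phi>)) *
      indicator {\<phi>. norm (snd \<phi>) \<le> \<rho> * (1 + norm (fst \<phi>))} \<phi>)"
    have W: "integrable P W"
      unfolding W_def using k0(2)[OF k] \<rho>(1) by simp
    have bnd: "overlap K L \<phi> ^ k * (1 + norm (fst \<phi>)) \<le> C ^ k * W \<phi>" for \<phi>
    proof (cases "overlap K L \<phi> = 0")
      \<comment> \<open>\<open>1 \<le> k\<close> matters here: the power has to vanish off the
        support, and \<open>0 ^ 0 = 1\<close>.\<close>
      case True
      then show ?thesis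
        using k k0(1) C(1) by (simp add: W_def power_0_left indicator_def)
    next
      case False
      have pos: "0 < 1 + norm (fst \<phi>)" by (simp add: add_pos_nonneg)
      have "overlap K L \<phi> \<le> C * inverse (1 + norm (fst \<phi>))"
        using C(2)[of \<phi>] pos by (simp add: field_simps)
      then have "overlap K L \<phi> ^ k \<le> C ^ k * inverse (1 + norm (fst \<phi>)) ^ k"
        using power_mono[OF _ overlap_nonneg] by (metis power_mult_distrib)
      then have "overlap K L \<phi> ^ k * (1 + norm (fst \<phi>)) \<le>
          C ^ k * inverse (1 + norm (fst \<phi>)) ^ k * (1 + norm (fst \<phi>))"
        using pos by (intro mult_right_mono) auto
      moreover have "W \<phi> = inverse (1 + norm (fst \<phi>)) ^ k * (1 + norm (fst \<phi>))"
        using overlap_support[OF \<rho>(2,3) False] by (simp add: W_def)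
      ultimately show ?thesis
        by (simp only: mult.assoc)
    qed
    note [measurable] = borel_measurable_overlap[OF K L] borel_measurable_aff_saff[of v]
    have o: "0 \<le> overlap K L \<phi> ^ k" for \<phi> by (simp add: overlap_nonneg)
    have "integrable P (\<lambda>\<phi>. overlap K L \<phi> ^ k)"
    proof (rule Bochner_Integration.integrable_bound)
      show "integrable P (\<lambda>\<phi>. C ^ k * W \<phi>)" using W by simp
      have "norm (overlap K L \<phi> ^ k) \<le> norm (C ^ k * W \<phi>)" for \<phi>
        using bnd[of \<phi>] mult_left_mono[OF _ o[of \<phi>], of 1 "1 + norm (fst \<phi>)"] o[of \<phi>] by simp
      then show "AE \<phi> in P. norm (overlap K L \<phi> ^ k) \<le> norm (C ^ k * W \<phi>)" by simp
    qed measurable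
    moreover have "integrable P (\<lambda>\<phi>. overlap K L \<phi> ^ k *\<^sub>R aff \<phi> v)"
    proof (rule Bochner_Integration.integrable_bound)
      show "integrable P (\<lambda>\<phi>. (norm v + \<rho>) * (C ^ k * W \<phi>))" using W by simp
      have "norm (overlap K L \<phi> ^ k *\<^sub>R aff \<phi> v) \<le> norm ((norm v + \<rho>) * (C ^ k * W \<phi>))" for \<phi>
      proof (cases "overlap K L \<phi> = 0")
        case True
        then show ?thesis using k k0(1) by (simp add: power_0_left)
      next
        case False
        have "norm (aff \<phi> v) \<le> norm (fst \<phi>) * norm v + norm (snd \<phi>)"
          using norm_matrix_vector_mult_le[of "fst \<phi>" v] norm_triangle_ineq[of "fst \<phi> *v v" "snd \<phi>"]
          by (simp add: aff_def)
        also have "\<dots> \<le> (norm v + \<rho>) * (1 + norm (fst \<phi>))"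
          using overlap_support[OF \<rho>(2,3) False]
          by (simp add: algebra_simps) (use norm_ge_zero[of v] in linarith)
        finally have "overlap K L \<phi> ^ k * norm (aff \<phi> v) \<le>
            overlap K L \<phi> ^ k * ((norm v + \<rho>) * (1 + norm (fst \<phi>)))"
          by (rule mult_left_mono[OF _ o])
        also have "\<dots> = (norm v + \<rho>) * (overlap K L \<phi> ^ k * (1 + norm (fst \<phi>)))"
          by (simp only: mult.left_commute)
        also have "\<dots> \<le> (norm v + \<rho>) * (C ^ k * W \<phi>)"
          using \<rho>(1) by (intro mult_left_mono bnd) simp
        also have "\<dots> \<le> norm ((norm v + \<rho>) * (C ^ k * W \<phi>))"
          unfolding real_norm_def by (rule abs_ge_self)
        finally show ?thesis
          unfolding norm_scaleR abs_of_nonneg[OF o] .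
      qed
      then show "AE \<phi> in P. norm (overlap K L \<phi> ^ k *\<^sub>R aff \<phi> v) \<le> norm ((norm v + \<rho>) * (C ^ k * W \<phi>))"
        by simp
    qed measurable
    ultimately show ?thesis by (simp add: T_unit_defined_def)
  qed
  with k0(1) show thesis using that by blast
qed

end

section \<open>Equivariance\<close>

lemma inj_aff: "invertible (fst \<gamma>) \<Longrightarrow> inj (aff \<gamma>)"
  by (metis aff_inverseE inj_on_inverseI prod.collapse)

text \<open>Nonempty interior is transported through volume: a convex set has empty interior exactly
  when it is negligible, and volume is multiplied by a nonzero determinant.\<close>

lemma convex_body_aff_image:
  assumes "invertible (fst \<gamma>)" "convex_body M"
  shows "convex_body (aff \<gamma> ` M)"
proof -
  obtain r x where \<gamma>: "\<gamma> = (r, x)" by (cases \<gamma>)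
  have M: "compact M" "convex M" "M \<in> lmeasurable"
    using assms(2) by (auto simp: convex_body_def lmeasurable_compact)
  have "measure lebesgue (aff \<gamma> ` M) \<noteq> 0"
    using assms convex_body_measure_pos[OF assms(2)]
    by (auto simp: \<gamma> measure_aff_image[OF M(3)] invertible_det_nz)
  then have "\<not> negligible (aff \<gamma> ` M)"
    by (auto simp: negligible_iff_measure)
  moreover have "convex (aff \<gamma> ` M)"
    unfolding \<gamma> by (intro convex_aff_image M)
  ultimately show ?thesis
    using compact_aff_image[OF M(1)] by (simp add: convex_body_def negligible_convex_interior)
qed

section \<open>Rescaling to unit volume\<close>

lemma det_scaleR_matrix: "det (c *\<^sub>R A) = c ^ CARD('n) * det (A :: real ^ 'n ^ 'n)"
proof -
  have "c *\<^sub>R A = (c *\<^sub>R mat 1) ** A"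
    by (simp add: bounded_bilinear.scaleR_left[OF bounded_bilinear_matrix_matrix_mult])
  moreover have "det (c *\<^sub>R mat 1 :: real ^ 'n ^ 'n) = c ^ CARD('n)"
    by (subst det_diagonal) (auto simp: mat_def)
  ultimately show ?thesis by (simp add: det_mul)
qed

lemma vol_root_pos: "convex_body L \<Longrightarrow> 0 < vol_root L"
  by (simp add: vol_root_def convex_body_measure_pos)

lemma normalized_eq_aff_image: "normalized L = aff (inverse (vol_root L) *\<^sub>R mat 1, 0) ` L"
  by (simp add: normalized_def aff_def scaleR_matrix_vector_assoc[symmetric])

lemma mem_normalized_iff:
  assumes "convex_body L"
  shows "y \<in> normalized L \<longleftrightarrow> vol_root L *\<^sub>R y \<in> L"
proof
  assume "vol_root L *\<^sub>R y \<in> L"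
  moreover have "y = (vol_root L *\<^sub>R y) /\<^sub>R vol_root L"
    using vol_root_pos[OF assms] by simp
  ultimately show "y \<in> normalized L"
    unfolding normalized_def by blast
qed (use vol_root_pos[OF assms] in \<open>auto simp: normalized_def\<close>)

lemma convex_body_normalized:
  assumes "convex_body L"
  shows "convex_body (normalized L)"
proof -
  have "invertible (inverse (vol_root L) *\<^sub>R mat 1 :: real ^ 'a ^ 'a)"
    using vol_root_pos[OF assms] by (simp add: invertible_det_nz det_scaleR_matrix)
  then show ?thesis
    unfolding normalized_eq_aff_image using assms by (intro convex_body_aff_image) auto
qed

lemma measure_normalized:
  assumes "convex_body L"
  shows "measure lebesgue (normalized (L :: (real ^ 'n) set)) = 1"
proof -
  have "L \<in> lmeasurable"
    using assms by (simp add: convex_body_def lmeasurable_compact)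
  then have "measure lebesgue (normalized L) = inverse (vol_root L) ^ CARD('n) * measure lebesgue L"
    using vol_root_pos[OF assms] by (simp add: normalized_eq_aff_image measure_aff_image det_scaleR_matrix)
  also have "measure lebesgue L = vol_root L ^ CARD('n)"
    by (simp add: vol_root_def)
  finally show ?thesis
    using vol_root_pos[OF assms] by (simp add: power_mult_distrib[symmetric])
qed

lemma normalized_unit: "measure lebesgue L = 1 \<Longrightarrow> normalized L = L"
  by (simp add: normalized_def vol_root_def)

text \<open>Left multiplication in SAff(n), written so that each component of the result depends on
  one component of \<open>\<phi>\<close> only: the matrix is translated by
  \<open>fst \<gamma>\<close>, the translation part is moved by \<open>aff \<gamma>\<close>
  itself.\<close>

definition aff_comp where
  "aff_comp \<gamma> \<phi> = (fst \<gamma> ** fst \<phi>, aff \<gamma> (snd \<phi>))"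

lemma aff_aff_comp: "aff (aff_comp \<gamma> \<phi>) a = aff \<gamma> (aff \<phi> a)"
  by (simp add: aff_comp_def aff_def matrix_vector_right_distrib matrix_vector_mul_assoc add.assoc)

lemma overlap_aff_image:
  assumes "invertible (fst \<gamma>)"
  shows "overlap K (aff \<gamma> ` M) (aff_comp \<gamma> \<phi>) = overlap K M \<phi>"
proof -
  have "aff (aff_comp \<gamma> \<phi>) -` aff \<gamma> ` M = aff \<phi> -` M"
    by (simp add: vimage_def aff_aff_comp inj_image_mem_iff[OF inj_aff[OF assms]])
  then show ?thesis by (simp add: overlap_def)
qed

text \<open>Translating an interior point of \<open>K\<close> onto one of \<open>L\<close> makes the
  interiors meet in a nonempty open set. The linear part stays the identity because neighbourhoods
  of \<open>mat 1\<close> are known to have positive Haar measure.\<close>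

lemma overlap_identity_pos:
  fixes K L :: "(real ^ 'n) set"
  assumes "convex_body K" "convex_body L"
  obtains x where "0 < overlap K L (mat 1, x)"
proof -
  obtain a b where ab: "a \<in> interior K" "b \<in> interior L"
    using assms by (auto simp: convex_body_def)
  let ?\<phi> = "(mat 1 :: real ^ 'n ^ 'n, b - a)"
  let ?U = "(\<lambda>z. z + (b - a)) -` interior L \<inter> interior K"
  have "open ?U"
    by (intro open_Int open_vimage continuous_intros) auto
  moreover have "a \<in> ?U" using ab by simp
  ultimately have "\<not> negligible ?U"
    using open_not_negligible by blast
  moreover have "?U \<subseteq> aff ?\<phi> -` L \<inter> K"
    using interior_subset[of K] interior_subset[of L] by (auto simp: aff_def)
  ultimately have "\<not> negligible (aff ?\<phi> -` L \<inter> K)"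
    using negligible_subset by blast
  moreover have "aff ?\<phi> -` L \<inter> K \<in> lmeasurable"
    using assms by (intro overlap_set_lmeasurable) (auto simp: convex_body_def compact_imp_closed)
  ultimately have "overlap K L ?\<phi> \<noteq> 0"
    by (simp add: overlap_def negligible_iff_measure)
  then have "0 < overlap K L ?\<phi>"
    using overlap_nonneg[of K L ?\<phi>] by linarith
  then show thesis by (rule that)
qed

context unimodular_haar
begin

lemma measurable_aff_comp:
  assumes "fst \<gamma> \<in> G"
  shows "aff_comp \<gamma> \<in> measurable P P"
proof -
  have "(\<lambda>\<phi>. (fst \<gamma> ** fst \<phi>, aff \<gamma> (snd \<phi>))) \<in> measurable (\<nu> \<Otimes>\<^sub>M lborel) (\<nu> \<Otimes>\<^sub>M lborel)"
    by (intro measurable_Pair measurable_compose[OF measurable_fst measurable_left_mult[OF assms]]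
        measurable_compose[OF measurable_snd]) simp
  then show ?thesis
    by (simp add: saff_measure_def aff_comp_def[abs_def])
qed

lemma distr_aff_comp:
  assumes "fst \<gamma> \<in> G"
  shows "distr P P (aff_comp \<gamma>) = P"
proof -
  obtain g y where \<gamma>: "\<gamma> = (g, y)" by (cases \<gamma>)
  have g: "g \<in> G" using assms by (simp add: \<gamma>)
  have 1: "distr lborel lborel (aff \<gamma>) = lborel"
    using distr_lborel_aff[OF g, of y] by (simp add: \<gamma> cong: distr_cong)
  have "distr \<nu> \<nu> ((**) g) \<Otimes>\<^sub>M distr lborel lborel (aff \<gamma>) =
      distr (\<nu> \<Otimes>\<^sub>M lborel) (\<nu> \<Otimes>\<^sub>M lborel) (\<lambda>(r, x). (g ** r, aff \<gamma> x))"
    by (intro pair_measure_distr measurable_left_mult g) (simp_all add: 1 lborel.sigma_finite_measure_axioms)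
  then show ?thesis
    unfolding 1 distr_left_mult[OF g]
    by (simp add: saff_measure_def aff_comp_def[abs_def] \<gamma> split_def)
qed

lemma integral_aff_comp:
  fixes f :: "_ \<Rightarrow> 'b::{banach, second_countable_topology}"
  assumes "fst \<gamma> \<in> G" "f \<in> borel_measurable P"
  shows "(\<integral>\<phi>. f (aff_comp \<gamma> \<phi>) \<partial>P) = (\<integral>\<phi>. f \<phi> \<partial>P)"
  using integral_distr[OF measurable_aff_comp[OF assms(1)] assms(2)]
  by (simp add: distr_aff_comp[OF assms(1)])

text \<open>Substitute \<open>aff_comp \<gamma> \<phi>\<close> for \<open>\<phi>\<close> in both
  integrals: the weight is unchanged and \<open>aff \<gamma>\<close> is applied to
  \<open>aff \<phi> v\<close>. A weighted mean commutes with affine maps as soon as the total weight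
  \<open>nz\<close> can be divided out.\<close>

lemma T_unit_aff_image:
  assumes \<gamma>: "fst \<gamma> \<in> G" and K: "compact K" and M: "convex_body M"
    and def: "T_unit_defined \<nu> k K v M" and nz: "(\<integral>\<phi>. overlap K M \<phi> ^ k \<partial>P) \<noteq> 0"
  shows "T_unit \<nu> k K v (aff \<gamma> ` M) = aff \<gamma> (T_unit \<nu> k K v M)"
proof -
  let ?F = "\<lambda>\<phi>. overlap K M \<phi> ^ k" and ?F' = "\<lambda>\<phi>. overlap K (aff \<gamma> ` M) \<phi> ^ k"
  have inv: "invertible (fst \<gamma>)" using \<gamma> by (rule unimodular_invertible)
  have ov: "overlap K (aff \<gamma> ` M) (aff_comp \<gamma> \<phi>) = overlap K M \<phi>" for \<phi>
    by (rule overlap_aff_image[OF inv])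
  note [measurable] = borel_measurable_overlap[OF K convex_body_aff_image[OF inv M]]
    borel_measurable_aff_saff[of v]
  have int: "integrable P ?F" "integrable P (\<lambda>\<phi>. ?F \<phi> *\<^sub>R aff \<phi> v)"
    using def by (auto simp: T_unit_defined_def)
  have bl: "bounded_linear ((*v) (fst \<gamma>))"
    by (rule bounded_bilinear.bounded_linear_right[OF bounded_bilinear_matrix_vector_mult])
  have 1: "(\<integral>\<phi>. ?F' \<phi> \<partial>P) = (\<integral>\<phi>. ?F \<phi> \<partial>P)"
    using integral_aff_comp[OF \<gamma>, of ?F'] by (simp add: ov)
  have "(\<integral>\<phi>. ?F' \<phi> *\<^sub>R aff \<phi> v \<partial>P) = (\<integral>\<phi>. ?F \<phi> *\<^sub>R aff \<gamma> (aff \<phi> v) \<partial>P)"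
    using integral_aff_comp[OF \<gamma>, of "\<lambda>\<phi>. ?F' \<phi> *\<^sub>R aff \<phi> v"] by (simp add: ov aff_aff_comp)
  also have "\<dots> = (\<integral>\<phi>. fst \<gamma> *v (?F \<phi> *\<^sub>R aff \<phi> v) + ?F \<phi> *\<^sub>R snd \<gamma> \<partial>P)"
    by (simp add: aff_def[of \<gamma>] scaleR_right_distrib matrix_vector_mult_scaleR)
  also have "\<dots> = fst \<gamma> *v (\<integral>\<phi>. ?F \<phi> *\<^sub>R aff \<phi> v \<partial>P) + (\<integral>\<phi>. ?F \<phi> \<partial>P) *\<^sub>R snd \<gamma>"
    using int by (simp add: Bochner_Integration.integral_add integrable_bounded_linear[OF bl]
        integral_bounded_linear[OF bl])
  finally have 2: "(\<integral>\<phi>. ?F' \<phi> *\<^sub>R aff \<phi> v \<partial>P) = \<dots>" .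
  show ?thesis
    unfolding T_unit_def 1 2 using nz
    by (simp add: aff_def scaleR_right_distrib matrix_vector_mult_scaleR)
qed

text \<open>By continuity the superlevel set contains a product of neighbourhoods of
  \<open>mat 1\<close> and \<open>x\<close>; radii \<open>d / 2\<close> suffice because the product
  distance is at most the sum of the two. It serves both the denominator of \<open>T_unit\<close>
  and the concentration argument.\<close>

lemma emeasure_superlevel_pos:
  fixes f :: "_ \<Rightarrow> real"
  assumes f: "continuous_on (G \<times> UNIV) f" and c: "c < f (mat 1, x)"
  shows "0 < emeasure P {\<phi> \<in> space P. c < f \<phi>}"
proof -
  note [measurable] = borel_measurable_saff[OF f]
  have "\<exists>d>0. \<forall>\<phi>\<in>G \<times> UNIV. dist \<phi> (mat 1, x) < d \<longrightarrow> dist (f \<phi>) (f (mat 1, x)) < f (mat 1, x) - c"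
    using f c unfolding continuous_on_iff by simp
  then obtain d where d: "0 < d"
    "\<And>\<phi>. \<phi> \<in> G \<times> UNIV \<Longrightarrow> dist \<phi> (mat 1, x) < d \<Longrightarrow> dist (f \<phi>) (f (mat 1, x)) < f (mat 1, x) - c"
    by blast
  let ?V = "G \<inter> ball (mat 1) (d / 2)"
  have V: "?V \<in> sets \<nu>"
    by (auto simp: sets_haar_iff closed_unimodular_matrices)
  have "?V \<times> ball x (d / 2) \<subseteq> {\<phi> \<in> space P. c < f \<phi>}"
  proof
    fix \<phi> assume \<phi>: "\<phi> \<in> ?V \<times> ball x (d / 2)"
    then have "dist (fst \<phi>) (mat 1) < d / 2" "dist (snd \<phi>) x < d / 2"
      by (auto simp: dist_commute)
    then have "dist \<phi> (mat 1, x) < d"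
      using sqrt_sum_squares_le_sum[of "dist (fst \<phi>) (mat 1)" "dist (snd \<phi>) x"]
      by (simp add: dist_prod_def)
    with d(2)[of \<phi>] \<phi> have "dist (f \<phi>) (f (mat 1, x)) < f (mat 1, x) - c" by auto
    then have "c < f \<phi>" by (simp add: dist_real_def abs_if split: if_splits)
    then show "\<phi> \<in> {\<phi> \<in> space P. c < f \<phi>}" using \<phi> by (auto simp: space_saff)
  qed
  then have "emeasure P (?V \<times> ball x (d / 2)) \<le> emeasure P {\<phi> \<in> space P. c < f \<phi>}"
    by (rule emeasure_mono) measurable
  moreover have "emeasure P (?V \<times> ball x (d / 2)) = emeasure \<nu> ?V * emeasure lborel (ball x (d / 2))"
    unfolding saff_measure_def using V by (intro lborel.emeasure_pair_measure_Times) auto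
  moreover have "0 < emeasure \<nu> ?V" using emeasure_haar_ball_pos d(1) by simp
  moreover have "0 < emeasure lborel (ball x (d / 2))"
    using content_ball_pos[of "d / 2" x] d(1)
    by (metis enn2real_0 half_gt_zero measure_def not_gr_zero less_irrefl)
  ultimately have "0 < emeasure P (?V \<times> ball x (d / 2))"
    "emeasure P (?V \<times> ball x (d / 2)) \<le> emeasure P {\<phi> \<in> space P. c < f \<phi>}"
    by (simp_all add: ennreal_zero_less_mult_iff)
  then show ?thesis by (rule less_le_trans)
qed

text \<open>Guarantees that \<open>inverse\<close> in \<open>T_unit\<close> is a true division and
  not the default \<open>inverse 0 = 0\<close>.\<close>

lemma integral_overlap_power_pos:
  assumes "convex_body K" "convex_body L" "integrable P (\<lambda>\<phi>. overlap K L \<phi> ^ k)"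
  shows "0 < (\<integral>\<phi>. overlap K L \<phi> ^ k \<partial>P)"
proof -
  have K: "compact K" using assms(1) by (simp add: convex_body_def)
  obtain x where "0 < overlap K L (mat 1, x)"
    using overlap_identity_pos[OF assms(1,2)] by blast
  from emeasure_superlevel_pos[OF continuous_on_overlap[OF K assms(2)] this]
  have "0 < emeasure P {\<phi> \<in> space P. 0 < overlap K L \<phi>}" .
  moreover have "{\<phi> \<in> space P. 0 < overlap K L \<phi>} \<subseteq> {\<phi> \<in> space P. \<not> overlap K L \<phi> ^ k = 0}" by auto
  moreover have "{\<phi> \<in> space P. \<not> overlap K L \<phi> ^ k = 0} \<in> sets P"
    using borel_measurable_integrable[OF assms(3)] by measurable
  ultimately have "0 < emeasure P {\<phi> \<in> space P. \<not> overlap K L \<phi> ^ k = 0}"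
    by (meson emeasure_mono less_le_trans)
  then have "\<not> (AE \<phi> in P. overlap K L \<phi> ^ k = 0)"
    using \<open>_ \<in> sets P\<close> by (subst AE_iff_measurable) auto
  then have "(\<integral>\<phi>. overlap K L \<phi> ^ k \<partial>P) \<noteq> 0"
    using integral_nonneg_eq_0_iff_AE[OF assms(3)] by (simp add: overlap_nonneg)
  then show ?thesis
    using Bochner_Integration.integral_nonneg[of P "\<lambda>\<phi>. overlap K L \<phi> ^ k"] by (simp add: overlap_nonneg less_le)
qed

lemma T_point_aff_image:
  assumes K: "convex_body K" and L: "convex_body L" and \<phi>: "invertible (fst \<phi>)"
    and def: "T_defined \<nu> k K v L"
  shows "T_point \<nu> k K v (aff \<phi> ` L) = aff \<phi> (T_point \<nu> k K v L)"
proof -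
  obtain A b where Ab: "\<phi> = (A, b)" by (cases \<phi>)
  have "det A \<noteq> 0" using \<phi> by (simp add: Ab invertible_det_nz)
  define c where "c = root CARD('n) \<bar>det A\<bar>"
  define s where "s = vol_root L"
  have c: "0 < c" "c ^ CARD('n) = \<bar>det A\<bar>"
    using \<open>det A \<noteq> 0\<close> by (simp_all add: c_def)
  have s: "0 < s" unfolding s_def by (rule vol_root_pos[OF L])
  have "L \<in> lmeasurable" using L by (simp add: convex_body_def lmeasurable_compact)
  then have vol: "vol_root (aff \<phi> ` L) = c * s"
    by (simp add: vol_root_def Ab measure_aff_image real_root_mult c_def s_def)
  \<comment> \<open>The map induced by \<open>\<phi>\<close> on normalized bodies: the matrix is
    divided by \<open>c\<close> to have determinant +-1, the translation by \<open>c * s\<close>,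
    the volume root of the image.\<close>
  define \<gamma> where "\<gamma> = (inverse c *\<^sub>R A, inverse (c * s) *\<^sub>R b)"
  have "\<bar>det (fst \<gamma>)\<bar> = inverse c ^ CARD('n) * c ^ CARD('n)"
    unfolding c(2) using c(1) by (simp add: \<gamma>_def det_scaleR_matrix abs_mult)
  also have "\<dots> = 1"
    using c(1) by (simp add: power_mult_distrib[symmetric])
  finally have \<gamma>: "fst \<gamma> \<in> G" by (simp add: unimodular_abs_det)
  have "inverse (c * s) *\<^sub>R aff \<phi> x = aff \<gamma> (inverse s *\<^sub>R x)" for x
    by (simp add: aff_def Ab \<gamma>_def scaleR_right_distrib matrix_vector_mult_scaleR
        scaleR_matrix_vector_assoc[symmetric])
  then have norm: "normalized (aff \<phi> ` L) = aff \<gamma> ` normalized L"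
    by (simp add: normalized_def vol s_def[symmetric] image_image)
  have def': "T_unit_defined \<nu> k K v (normalized L)"
    using def by (simp add: T_defined_def)
  have "(\<integral>\<phi>. overlap K (normalized L) \<phi> ^ k \<partial>P) \<noteq> 0"
    using integral_overlap_power_pos[OF K convex_body_normalized[OF L], of k] def'
    by (simp add: T_unit_defined_def)
  then have "T_unit \<nu> k K v (normalized (aff \<phi> ` L)) = aff \<gamma> (T_unit \<nu> k K v (normalized L))"
    unfolding norm using K convex_body_normalized[OF L] def' \<gamma>
    by (intro T_unit_aff_image) (auto simp: convex_body_def)
  moreover have "c * s * inverse c = s" "c * s * (inverse c * inverse s) = 1"
    using c(1) s by (simp_all add: field_simps)
  ultimately show ?thesis
    unfolding T_point_def vol s_def[symmetric]
    by (simp add: aff_def Ab \<gamma>_def scaleR_right_distrib matrix_vector_mult_scaleR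
        scaleR_matrix_vector_assoc[symmetric])
qed

end

section \<open>Continuity\<close>

lemma hausdorff_dist_nonneg:
  assumes "convex_body K" "convex_body L"
  shows "0 \<le> hausdorff_dist K L"
proof -
  obtain x where "x \<in> K" using convex_body_nonempty[OF assms(1)] by blast
  then have "infdist x L \<le> hausdorff_dist K L"
    using assms by (intro infdist_le_hausdorff_dist) (auto simp: convex_body_def)
  then show ?thesis
    using infdist_nonneg[of x L] by linarith
qed

lemma uniformly_bounded_of_hausdorff_tendsto:
  assumes L: "convex_body L" and M: "\<And>j. convex_body (M j)"
    and lim: "(\<lambda>j. hausdorff_dist L (M j)) \<longlonglongrightarrow> 0"
  obtains R where "0 < R" "\<And>j. M j \<subseteq> cball 0 R"
proof -
  obtain B where B: "\<And>j. \<bar>hausdorff_dist L (M j)\<bar> \<le> B"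
    using convergent_imp_Bseq[of "\<lambda>j. hausdorff_dist L (M j)"] lim
    by (auto simp: Bseq_def convergent_def)
  have cL: "compact L" "closed L" "L \<noteq> {}"
    using L convex_body_nonempty[OF L] by (auto simp: convex_body_def compact_imp_closed)
  obtain \<rho> where \<rho>: "0 < \<rho>" "L \<subseteq> ball 0 \<rho>"
    using bounded_subset_ballD[OF compact_imp_bounded[OF cL(1)]] by blast
  have "M j \<subseteq> cball 0 (B + \<rho>)" for j
  proof
    fix y assume "y \<in> M j"
    then have "infdist y L \<le> hausdorff_dist L (M j)"
      using cL M[of j] by (intro infdist_le_hausdorff_dist) (auto simp: convex_body_def)
    moreover obtain x where "x \<in> L" "infdist y L = dist y x"
      using infdist_attains_inf[OF cL(2,3)] by blast
    moreover have "norm x < \<rho>" using \<rho>(2) \<open>x \<in> L\<close> by auto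
    moreover have "norm y \<le> dist y x + norm x"
      using norm_triangle_ineq[of "y - x" x] by (simp add: dist_norm)
    ultimately show "y \<in> cball 0 (B + \<rho>)"
      using B[of j] by simp
  qed
  moreover have "0 < B + \<rho>"
    using B[of 0] \<rho>(1) by linarith
  ultimately show thesis using that by blast
qed

text \<open>A volume is the overlap, under the identity map, with one ball containing all the
  bodies, so \<open>overlap_tendsto\<close> applies again.\<close>

lemma vol_root_tendsto:
  assumes L: "convex_body L" and M: "\<And>j. convex_body (M j)"
    and lim: "(\<lambda>j. hausdorff_dist L (M j)) \<longlonglongrightarrow> 0"
  shows "(\<lambda>j. vol_root (M j)) \<longlonglongrightarrow> vol_root (L :: (real ^ 'n) set)"
proof -
  obtain R where R: "0 < R" "\<And>j. M j \<subseteq> cball 0 R"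
    using uniformly_bounded_of_hausdorff_tendsto[OF L M lim] by blast
  obtain R' where R': "L \<subseteq> ball 0 R'"
    using bounded_subset_ballD[OF compact_imp_bounded, of L] L unfolding convex_body_def by blast
  let ?B = "cball (0 :: real ^ 'n) (max R R')"
  have eq: "overlap ?B A (mat 1, 0) = measure lebesgue A" if "A \<subseteq> ?B" for A :: "(real ^ 'n) set"
    using that by (simp add: overlap_def Int_absorb2)
  have "(\<lambda>j. overlap ?B (M j) (mat 1, 0)) \<longlonglongrightarrow> overlap ?B L (mat 1, 0)"
  proof (rule overlap_tendsto[where Z = "frontier L"])
    show "closed L" "negligible (frontier L)" "closed (M j)" for j
      using L M[of j] by (auto simp: convex_body_def compact_imp_closed negligible_convex_frontier)
    show "\<forall>\<^sub>F j in sequentially. (Y j \<in> M j) = (y \<in> L)" if "y \<notin> frontier L" "Y \<longlonglongrightarrow> y" for y Y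
      by (rule eventually_mem_iff_of_hausdorff_tendsto[OF L M lim that])
  qed (auto simp: unimodular_invertible)
  moreover have "M j \<subseteq> ?B" "L \<subseteq> ?B" for j
    using R(2)[of j] R' by fastforce+
  ultimately have "(\<lambda>j. measure lebesgue (M j)) \<longlonglongrightarrow> measure lebesgue L"
    by (simp add: eq)
  then show ?thesis
    unfolding vol_root_def by (rule tendsto_real_root)
qed

text \<open>Hausdorff convergence of the normalized bodies is never proved. Membership of
  \<open>Y j\<close> is pulled back to membership of \<open>vol_root (M j) *\<^sub>R Y j\<close> in
  \<open>M j\<close>, where moving points are allowed.\<close>

lemma overlap_normalized_tendsto:
  assumes K: "compact K" and L: "convex_body L" and M: "\<And>j. convex_body (M j)"
    and lim: "(\<lambda>j. hausdorff_dist L (M j)) \<longlonglongrightarrow> 0" and \<phi>: "invertible (fst \<phi>)"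
  shows "(\<lambda>j. overlap K (normalized (M j)) \<phi>) \<longlonglongrightarrow> overlap K (normalized L) \<phi>"
proof -
  let ?s = "vol_root L"
  have s: "0 < ?s" by (rule vol_root_pos[OF L])
  let ?Z = "aff (inverse ?s *\<^sub>R mat 1, 0) ` frontier L"
  show ?thesis
  proof (rule overlap_tendsto[where Z = ?Z])
    show "closed (normalized L)" "closed (normalized (M j))" for j
      using convex_body_normalized[OF L] convex_body_normalized[OF M[of j]]
      by (auto simp: convex_body_def compact_imp_closed)
    show "negligible ?Z"
      using L by (intro negligible_aff_image negligible_convex_frontier) (simp add: convex_body_def)
    show "\<forall>\<^sub>F j in sequentially. (Y j \<in> normalized (M j)) = (y \<in> normalized L)"
      if y: "y \<notin> ?Z" and Y: "Y \<longlonglongrightarrow> y" for y Y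
      unfolding mem_normalized_iff[OF L] mem_normalized_iff[OF M]
    proof (rule eventually_mem_iff_of_hausdorff_tendsto[OF L M lim])
      show "?s *\<^sub>R y \<notin> frontier L"
      proof
        assume "?s *\<^sub>R y \<in> frontier L"
        moreover have "y = aff (inverse ?s *\<^sub>R mat 1, 0) (?s *\<^sub>R y)"
          using s by (simp add: aff_def scaleR_matrix_vector_assoc[symmetric])
        ultimately show False using y by blast
      qed
      show "(\<lambda>j. vol_root (M j) *\<^sub>R Y j) \<longlonglongrightarrow> ?s *\<^sub>R y"
        by (intro tendsto_scaleR vol_root_tendsto L M lim Y)
    qed
  qed (use K \<phi> in auto)
qed

text \<open>Each summand is replaced by the largest one; the crude factor is harmless in an
  integrable majorant. \<open>1 \<le> k\<close> is what the empty sum needs, since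
  \<open>0 ^ 0 = 1\<close>.\<close>

lemma sum_power_le:
  fixes a :: "'a \<Rightarrow> real"
  assumes "finite S" "\<And>x. x \<in> S \<Longrightarrow> 0 \<le> a x" "1 \<le> k"
  shows "(\<Sum>x\<in>S. a x) ^ k \<le> real (card S) ^ k * (\<Sum>x\<in>S. a x ^ k)"
proof (cases "S = {}")
  case True
  then show ?thesis using assms(3) by (simp add: power_0_left)
next
  case False
  define m where "m = Max (a ` S)"
  have "m \<in> a ` S" unfolding m_def using assms(1) False by (intro Max_in) auto
  then obtain y where y: "y \<in> S" "m = a y" by blast
  have "(\<Sum>x\<in>S. a x) \<le> (\<Sum>x\<in>S. m)"
    using assms(1) by (intro sum_mono) (simp add: m_def)
  then have "(\<Sum>x\<in>S. a x) ^ k \<le> (real (card S) * m) ^ k"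
    using assms(2) by (intro power_mono sum_nonneg) auto
  also have "\<dots> = real (card S) ^ k * a y ^ k"
    by (simp add: power_mult_distrib y)
  also have "\<dots> \<le> real (card S) ^ k * (\<Sum>x\<in>S. a x ^ k)"
    using assms y(1) by (intro mult_left_mono member_le_sum) auto
  finally show ?thesis .
qed

lemma overlap_le_sum_cover:
  assumes "compact K" "closed L" "finite S" "\<And>p. p \<in> S \<Longrightarrow> closed (Q p)" "L \<subseteq> (\<Union>p\<in>S. Q p)"
  shows "overlap K L \<phi> \<le> (\<Sum>p\<in>S. overlap K (Q p) \<phi>)"
proof -
  have m: "aff \<phi> -` Q p \<inter> K \<in> lmeasurable" if "p \<in> S" for p
    using assms(1,4) that by (intro overlap_set_lmeasurable) auto
  have "overlap K L \<phi> \<le> measure lebesgue (\<Union>p\<in>S. aff \<phi> -` Q p \<inter> K)"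
    unfolding overlap_def
  proof (intro measure_mono_fmeasurable fmeasurable.finite_UN assms(3) m
      fmeasurableD[OF overlap_set_lmeasurable[OF assms(1,2)]])
    show "aff \<phi> -` L \<inter> K \<subseteq> (\<Union>p\<in>S. aff \<phi> -` Q p \<inter> K)"
      by (auto dest!: subsetD[OF assms(5)])
  qed
  also have "\<dots> \<le> (\<Sum>p\<in>S. overlap K (Q p) \<phi>)"
    unfolding overlap_def by (intro measure_UNION_le assms(3) fmeasurableD m)
  finally show ?thesis .
qed

text \<open>Of volume 1, hence fixed by \<open>normalized\<close>: the assumed convergence of the
  integrals applies to it unscaled and at every centre.\<close>

definition unit_cube :: "real ^ 'n \<Rightarrow> (real ^ 'n) set" where
  "unit_cube c = cbox (c - (\<chi> k. 1 / 2)) (c + (\<chi> k. 1 / 2))"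

lemma mem_interior_unit_cube: "c \<in> interior (unit_cube c)"
  by (simp add: unit_cube_def mem_box_cart)

lemma convex_body_unit_cube: "convex_body (unit_cube c)"
  using mem_interior_unit_cube[of c] by (auto simp: convex_body_def unit_cube_def)

lemma normalized_unit_cube: "normalized (unit_cube c) = unit_cube c"
  using content_cube[of "1 / 2" c] by (intro normalized_unit) (simp add: unit_cube_def)

lemma compact_cover_unit_cubes:
  fixes S :: "(real ^ 'n) set"
  assumes "compact S"
  obtains C where "finite C" "S \<subseteq> (\<Union>c\<in>C. unit_cube c)"
proof -
  have "\<forall>U\<in>(\<lambda>c. interior (unit_cube c)) ` S. open U" by auto
  moreover have "S \<subseteq> \<Union>((\<lambda>c. interior (unit_cube c)) ` S)"
    using mem_interior_unit_cube by blast
  ultimately obtain D where D: "D \<subseteq> (\<lambda>c. interior (unit_cube c)) ` S" "finite D" "S \<subseteq> \<Union>D"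
    using assms by (metis compact_eq_Heine_Borel)
  obtain C where C: "C \<subseteq> S" "finite C" "D = (\<lambda>c. interior (unit_cube c)) ` C"
    using finite_subset_image[OF D(2,1)] by blast
  have "\<Union>D \<subseteq> (\<Union>c\<in>C. unit_cube c)"
    unfolding C(3) using interior_subset by fast
  with that[OF C(2)] D(3) show thesis by blast
qed

context unimodular_haar
begin

text \<open>
  For small \<open>k\<close> the only integrability available is the one assumed for bodies of volume 1; a large
  ball is handled by covering it with unit cubes.
\<close>

lemma T_point_tendsto:
  assumes K: "convex_body K" and k: "1 \<le> k"
    and def: "\<And>L. convex_body L \<Longrightarrow> T_defined \<nu> k K v L"
    and L: "convex_body L" and M: "\<And>j. convex_body (M j)"
    and lim: "(\<lambda>j. hausdorff_dist L (M j)) \<longlonglongrightarrow> 0"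
  shows "(\<lambda>j. T_point \<nu> k K v (M j)) \<longlonglongrightarrow> T_point \<nu> k K v L"
proof -
  have cK: "compact K" using K by (simp add: convex_body_def)
  note nL = convex_body_normalized[OF L] and nM = convex_body_normalized[OF M]
  obtain R where R: "0 < R" "\<And>j. M j \<subseteq> cball 0 R"
    using uniformly_bounded_of_hausdorff_tendsto[OF L M lim] by blast
  note vol = vol_root_tendsto[OF L M lim]
  have "(\<lambda>j. inverse (vol_root (M j))) \<longlonglongrightarrow> inverse (vol_root L)"
    using vol_root_pos[OF L] by (intro tendsto_inverse vol) simp
  then obtain B where B: "\<And>j. \<bar>inverse (vol_root (M j))\<bar> \<le> B"
    using convergent_imp_Bseq[of "\<lambda>j. inverse (vol_root (M j))"]
    by (auto simp: Bseq_def convergent_def)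
  have sub: "normalized (M j) \<subseteq> cball 0 (B * R)" for j
  proof (unfold normalized_def, intro image_subsetI)
    fix x assume "x \<in> M j"
    then have "norm x \<le> R" using R(2)[of j] by auto
    then have "\<bar>inverse (vol_root (M j))\<bar> * norm x \<le> B * R"
      using B[of j] R(1) abs_ge_zero[of "inverse (vol_root (M j))"]
      by (intro mult_mono) (simp_all del: abs_inverse)
    then show "x /\<^sub>R vol_root (M j) \<in> cball 0 (B * R)" by simp
  qed
  obtain C where C: "finite C" "cball (0 :: real ^ 'n) (B * R) \<subseteq> (\<Union>c\<in>C. unit_cube c)"
    using compact_cover_unit_cubes[OF compact_cball] by blast
  have cube: "integrable P (\<lambda>\<phi>. overlap K (unit_cube c) \<phi> ^ k)"
    "integrable P (\<lambda>\<phi>. overlap K (unit_cube c) \<phi> ^ k *\<^sub>R aff \<phi> v)" for c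
    using def[OF convex_body_unit_cube[of c]]
    by (auto simp: T_defined_def normalized_unit_cube T_unit_defined_def)
  \<comment> \<open>Majorants valid for all \<open>j\<close>: the overlap is at most the sum over
    the covering cubes, and \<open>sum_power_le\<close> moves the power inside the sum, where
    \<open>cube\<close> gives integrability.\<close>
  define W where "W = (\<lambda>\<phi>. real (card C) ^ k * (\<Sum>c\<in>C. overlap K (unit_cube c) \<phi> ^ k))"
  define W' where "W' = (\<lambda>\<phi>. real (card C) ^ k * (\<Sum>c\<in>C. norm (overlap K (unit_cube c) \<phi> ^ k *\<^sub>R aff \<phi> v)))"
  have W: "integrable P W" "integrable P W'"
    unfolding W_def W'_def
    by (intro integrable_mult_right Bochner_Integration.integrable_sum integrable_norm cube)+
  have le: "overlap K (normalized (M j)) \<phi> ^ k \<le> W \<phi>" for j \<phi>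
  proof -
    have "overlap K (normalized (M j)) \<phi> \<le> (\<Sum>c\<in>C. overlap K (unit_cube c) \<phi>)"
    proof (rule overlap_le_sum_cover[OF cK _ C(1)])
      show "closed (normalized (M j))"
        using nM[of j] by (simp add: convex_body_def compact_imp_closed)
      show "normalized (M j) \<subseteq> (\<Union>c\<in>C. unit_cube c)"
        using sub[of j] C(2) by (rule order_trans)
      show "closed (unit_cube c)" for c :: "real ^ 'n"
        unfolding unit_cube_def by (rule closed_cbox)
    qed
    then have "overlap K (normalized (M j)) \<phi> ^ k \<le> (\<Sum>c\<in>C. overlap K (unit_cube c) \<phi>) ^ k"
      by (intro power_mono overlap_nonneg)
    also have "\<dots> \<le> W \<phi>"
      unfolding W_def by (intro sum_power_le C(1) k overlap_nonneg)
    finally show ?thesis .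
  qed
  have W': "W' \<phi> = W \<phi> * norm (aff \<phi> v)" for \<phi>
    by (simp add: W_def W'_def sum_distrib_right overlap_nonneg mult.assoc)
  note [measurable] = borel_measurable_overlap[OF cK nL] borel_measurable_overlap[OF cK nM]
    borel_measurable_aff_saff[of v]
  have pt: "(\<lambda>j. overlap K (normalized (M j)) \<phi>) \<longlonglongrightarrow> overlap K (normalized L) \<phi>"
    if "\<phi> \<in> space P" for \<phi>
    using that by (intro overlap_normalized_tendsto cK L M lim) (auto simp: space_saff unimodular_invertible)
  have I: "(\<lambda>j. \<integral>\<phi>. overlap K (normalized (M j)) \<phi> ^ k \<partial>P) \<longlonglongrightarrow> (\<integral>\<phi>. overlap K (normalized L) \<phi> ^ k \<partial>P)"
  proof (rule integral_dominated_convergence[OF _ _ W(1)])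
    show "AE \<phi> in P. (\<lambda>j. overlap K (normalized (M j)) \<phi> ^ k) \<longlonglongrightarrow> overlap K (normalized L) \<phi> ^ k"
      by (intro AE_I2 tendsto_power pt)
    show "AE \<phi> in P. norm (overlap K (normalized (M j)) \<phi> ^ k) \<le> W \<phi>" for j
      using le[of j] by (simp add: overlap_nonneg)
  qed measurable
  have J: "(\<lambda>j. \<integral>\<phi>. overlap K (normalized (M j)) \<phi> ^ k *\<^sub>R aff \<phi> v \<partial>P)
      \<longlonglongrightarrow> (\<integral>\<phi>. overlap K (normalized L) \<phi> ^ k *\<^sub>R aff \<phi> v \<partial>P)"
  proof (rule integral_dominated_convergence[OF _ _ W(2)])
    show "AE \<phi> in P. (\<lambda>j. overlap K (normalized (M j)) \<phi> ^ k *\<^sub>R aff \<phi> v)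
        \<longlonglongrightarrow> overlap K (normalized L) \<phi> ^ k *\<^sub>R aff \<phi> v"
      by (intro AE_I2 tendsto_scaleR tendsto_power pt tendsto_const)
    show "AE \<phi> in P. norm (overlap K (normalized (M j)) \<phi> ^ k *\<^sub>R aff \<phi> v) \<le> W' \<phi>" for j
      using le[of j] by (simp add: overlap_nonneg W' mult_right_mono)
  qed measurable
  have "(\<integral>\<phi>. overlap K (normalized L) \<phi> ^ k \<partial>P) \<noteq> 0"
    using integral_overlap_power_pos[OF K nL, of k] def[OF L]
    by (simp add: T_defined_def T_unit_defined_def)
  then show ?thesis
    unfolding T_point_def T_unit_def
    by (intro tendsto_scaleR tendsto_inverse vol I J)
qed

lemma affine_invariant_T_point:
  assumes K: "convex_body K" and k: "1 \<le> k"
    and def: "\<And>L. convex_body L \<Longrightarrow> T_defined \<nu> k K v L"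
  shows "affine_invariant_point (T_point \<nu> k K v)"
  unfolding affine_invariant_point_def
proof (intro conjI allI impI)
  fix L :: "(real ^ 'n) set" and e :: real
  assume L: "convex_body L" and e: "0 < e"
  show "\<exists>d>0. \<forall>M. convex_body M \<and> hausdorff_dist L M < d \<longrightarrow>
      dist (T_point \<nu> k K v L) (T_point \<nu> k K v M) < e"
  \<comment> \<open>The limit theorem is sequential, so a failure of continuity is turned into a
    sequence of bodies at distance less than 1 / (j + 1).\<close>
  proof (rule ccontr)
    assume "\<not> ?thesis"
    then have "\<forall>d. \<exists>M. 0 < d \<longrightarrow> convex_body M \<and> hausdorff_dist L M < d \<and>
        e \<le> dist (T_point \<nu> k K v L) (T_point \<nu> k K v M)"
      by (meson not_less)
    then obtain N where N: "\<And>d. 0 < d \<Longrightarrow> convex_body (N d) \<and> hausdorff_dist L (N d) < d \<and>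
        e \<le> dist (T_point \<nu> k K v L) (T_point \<nu> k K v (N d))"
      by metis
    define M where "M = (\<lambda>j. N (inverse (real (Suc j))))"
    have M: "convex_body (M j)" "hausdorff_dist L (M j) < inverse (real (Suc j))"
      "e \<le> dist (T_point \<nu> k K v L) (T_point \<nu> k K v (M j))" for j
      using N[of "inverse (real (Suc j))"] by (simp_all add: M_def)
    have "(\<lambda>j. hausdorff_dist L (M j)) \<longlonglongrightarrow> 0"
      by (rule tendsto_sandwich[OF _ _ tendsto_const LIMSEQ_inverse_real_of_nat])
        (intro always_eventually allI hausdorff_dist_nonneg L M(1) less_imp_le[OF M(2)])+
    from T_point_tendsto[OF K k def L M(1) this]
    have "(\<lambda>j. T_point \<nu> k K v (M j)) \<longlonglongrightarrow> T_point \<nu> k K v L" .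
    then have "\<forall>\<^sub>F j in sequentially. dist (T_point \<nu> k K v (M j)) (T_point \<nu> k K v L) < e"
      using e by (rule tendstoD)
    then obtain j where "dist (T_point \<nu> k K v (M j)) (T_point \<nu> k K v L) < e"
      by (auto simp: eventually_sequentially)
    with M(3)[of j] show False by (simp add: dist_commute)
  qed
next
  fix \<phi> :: "(real ^ 'n ^ 'n) \<times> (real ^ 'n)" and L :: "(real ^ 'n) set"
  assume "invertible (fst \<phi>) \<and> convex_body L"
  then show "T_point \<nu> k K v (aff \<phi> ` L) = aff \<phi> (T_point \<nu> k K v L)"
    using K def by (intro T_point_aff_image) auto
qed

end

section \<open>Concentration as the exponent grows\<close>

text \<open>Laplace's method: the weights \<open>F\<^sup>k\<close> concentrate where \<open>F\<close> is close to its supremum 1.\<close>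

lemma power_weighted_mean_tendsto_0:
  fixes F :: "'a \<Rightarrow> real" and f :: "'a \<Rightarrow> 'b::{banach, second_countable_topology}"
  assumes F: "F \<in> borel_measurable M" "\<And>x. 0 \<le> F x" "\<And>x. x \<in> space M \<Longrightarrow> F x \<le> 1"
    and int: "\<And>k. k0 \<le> k \<Longrightarrow> integrable M (\<lambda>x. F x ^ k)"
      "\<And>k. k0 \<le> k \<Longrightarrow> integrable M (\<lambda>x. F x ^ k *\<^sub>R f x)"
    and conc: "\<And>e. 0 < e \<Longrightarrow> \<exists>a<1. \<forall>x\<in>space M. a < F x \<longrightarrow> norm (f x) \<le> e"
    and pos: "\<And>b. b < 1 \<Longrightarrow> 0 < emeasure M {x \<in> space M. b < F x}"
  shows "(\<lambda>k. inverse (\<integral>x. F x ^ k \<partial>M) *\<^sub>R (\<integral>x. F x ^ k *\<^sub>R f x \<partial>M)) \<longlonglongrightarrow> 0"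
proof (rule tendstoI)
  fix e :: real assume "0 < e"
  note [measurable] = F(1)
  define \<epsilon> where "\<epsilon> = e / 2"
  have "0 < \<epsilon>" using \<open>0 < e\<close> by (simp add: \<epsilon>_def)
  obtain a' where a': "a' < 1" "\<And>x. x \<in> space M \<Longrightarrow> a' < F x \<Longrightarrow> norm (f x) \<le> \<epsilon>"
    using conc[OF \<open>0 < \<epsilon>\<close>] by blast
  define a where "a = max a' (1 / 2)"
  have a: "0 < a" "a < 1" "\<And>x. x \<in> space M \<Longrightarrow> a < F x \<Longrightarrow> norm (f x) \<le> \<epsilon>"
    using a' by (auto simp: a_def)
  \<comment> \<open>A level strictly between \<open>a\<close> and 1: the integral of
    \<open>F ^ k\<close> is at least of order \<open>b ^ k\<close>, while the region
    \<open>F \<le> a\<close> contributes at most order \<open>a ^ k\<close>, so its share decays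
    like \<open>(a / b) ^ k\<close>.\<close>
  define b where "b = (a + 1) / 2"
  have b: "a < b" "b < 1" "0 < b" using a(1,2) by (simp_all add: b_def)
  define A where "A = {x \<in> space M. b < F x}"
  have A [measurable]: "A \<in> sets M" unfolding A_def by measurable
  \<comment> \<open>The factor \<open>F x ^ k0\<close> is kept inside both integrals to secure
    convergence; only the remaining \<open>k - k0\<close> powers are estimated by \<open>a\<close>
    or \<open>b\<close>.\<close>
  define m where "m = (\<integral>x. F x ^ k0 * indicator A x \<partial>M)"
  define J where "J = (\<integral>x. norm (F x ^ k0 *\<^sub>R f x) \<partial>M)"
  define I where "I = (\<lambda>k. \<integral>x. F x ^ k \<partial>M)"
  have intA: "integrable M (\<lambda>x. F x ^ k0 * indicator A x)"
    using int(1)[of k0] A by (intro integrable_real_mult_indicator) auto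
  have "0 < m"
  proof -
    have "\<not> (AE x in M. F x ^ k0 * indicator A x = 0)"
    proof
      assume "AE x in M. F x ^ k0 * indicator A x = 0"
      then have "AE x in M. x \<notin> A"
        by eventually_elim (use b(3) in \<open>auto simp: A_def indicator_def split: if_splits\<close>)
      then have "emeasure M A = 0"
        using A by (subst (asm) AE_iff_measurable[of A]) (auto simp: A_def)
      with pos[OF b(2)] show False by (simp add: A_def)
    qed
    then have "m \<noteq> 0"
      unfolding m_def using integral_nonneg_eq_0_iff_AE[OF intA] F(2) by simp
    moreover have "0 \<le> m"
      unfolding m_def using F(2) by (intro Bochner_Integration.integral_nonneg) simp
    ultimately show ?thesis by simp
  qed
  have J: "integrable M (\<lambda>x. norm (F x ^ k0 *\<^sub>R f x))" "0 \<le> J"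
    using integrable_norm[OF int(2)[OF order_refl]] by (simp_all add: J_def)
  have lower: "b ^ (k - k0) * m \<le> I k" if k: "k0 \<le> k" for k
  proof -
    have "b ^ (k - k0) * m = (\<integral>x. b ^ (k - k0) * (F x ^ k0 * indicator A x) \<partial>M)"
      by (simp add: m_def)
    also have "\<dots> \<le> I k"
      unfolding I_def
    proof (rule integral_mono)
      fix x
      show "b ^ (k - k0) * (F x ^ k0 * indicator A x) \<le> F x ^ k"
      proof (cases "x \<in> A")
        case True
        then have "b ^ (k - k0) \<le> F x ^ (k - k0)"
          using b(3) by (intro power_mono) (auto simp: A_def)
        then have "b ^ (k - k0) * F x ^ k0 \<le> F x ^ (k - k0) * F x ^ k0"
          using F(2) by (intro mult_right_mono) auto
        then show ?thesis
          using True k by (simp flip: power_add)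
      qed (simp add: F(2))
    qed (use intA int(1)[OF k] in auto)
    finally show ?thesis .
  qed
  have upper: "norm (\<integral>x. F x ^ k *\<^sub>R f x \<partial>M) \<le> \<epsilon> * I k + a ^ (k - k0) * J" if k: "k0 \<le> k" for k
  proof -
    have "norm (\<integral>x. F x ^ k *\<^sub>R f x \<partial>M) \<le> (\<integral>x. norm (F x ^ k *\<^sub>R f x) \<partial>M)"
      by (rule integral_norm_bound)
    also have "\<dots> \<le> (\<integral>x. \<epsilon> * F x ^ k + a ^ (k - k0) * norm (F x ^ k0 *\<^sub>R f x) \<partial>M)"
    proof (rule integral_mono)
      fix x assume x: "x \<in> space M"
      show "norm (F x ^ k *\<^sub>R f x) \<le> \<epsilon> * F x ^ k + a ^ (k - k0) * norm (F x ^ k0 *\<^sub>R f x)"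
      proof (cases "a < F x")
        case True
        have "F x ^ k * norm (f x) \<le> F x ^ k * \<epsilon>"
          using a(3)[OF x True] F(2) by (intro mult_left_mono) auto
        moreover have "0 \<le> a ^ (k - k0) * norm (F x ^ k0 *\<^sub>R f x)"
          using a(1) by simp
        ultimately show ?thesis using F(2) by (simp add: mult.commute)
      next
        case False
        then have "F x ^ (k - k0) * norm (F x ^ k0 *\<^sub>R f x) \<le> a ^ (k - k0) * norm (F x ^ k0 *\<^sub>R f x)"
          using F(2) by (intro mult_right_mono power_mono) auto
        moreover have "norm (F x ^ k *\<^sub>R f x) = F x ^ (k - k0) * norm (F x ^ k0 *\<^sub>R f x)"
          using F(2) k by (simp add: mult.assoc[symmetric] power_add[symmetric])
        moreover have "0 \<le> \<epsilon> * F x ^ k"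
          using \<open>0 < \<epsilon>\<close> F(2) by simp
        ultimately show ?thesis by linarith
      qed
    qed (intro integrable_norm[OF int(2)[OF k]] Bochner_Integration.integrable_add
        integrable_mult_right int(1)[OF k] J(1))+
    also have "\<dots> = \<epsilon> * I k + a ^ (k - k0) * J"
      using int(1)[OF k] J(1) by (simp add: I_def J_def del: norm_scaleR)
    finally show ?thesis .
  qed
  have bound: "norm (inverse (I k) *\<^sub>R (\<integral>x. F x ^ k *\<^sub>R f x \<partial>M)) \<le> \<epsilon> + (a / b) ^ (k - k0) * (J / m)"
    if k: "k0 \<le> k" for k
  proof -
    have "0 < b ^ (k - k0) * m" using b(3) \<open>0 < m\<close> by simp
    then have Ik: "0 < I k" using lower[OF k] by linarith
    have "norm (inverse (I k) *\<^sub>R (\<integral>x. F x ^ k *\<^sub>R f x \<partial>M)) = norm (\<integral>x. F x ^ k *\<^sub>R f x \<partial>M) / I k"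
      using Ik by (simp add: divide_inverse mult.commute)
    also have "\<dots> \<le> (\<epsilon> * I k + a ^ (k - k0) * J) / I k"
      using upper[OF k] Ik by (intro divide_right_mono) auto
    also have "\<dots> = \<epsilon> + a ^ (k - k0) * J / I k"
      using Ik by (simp add: add_divide_distrib)
    also have "a ^ (k - k0) * J / I k \<le> a ^ (k - k0) * J / (b ^ (k - k0) * m)"
      using lower[OF k] Ik a(1) J(2) \<open>0 < b ^ (k - k0) * m\<close> by (intro divide_left_mono) auto
    also have "\<dots> = (a / b) ^ (k - k0) * (J / m)"
      by (simp add: power_divide)
    finally show ?thesis by simp
  qed
  have "(\<lambda>k. (a / b) ^ k) \<longlonglongrightarrow> 0"
    using a(1) b(1,3) by (intro LIMSEQ_realpow_zero) auto
  then have "(\<lambda>k. \<epsilon> + (a / b) ^ k * (J / m)) \<longlonglongrightarrow> \<epsilon> + 0 * (J / m)"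
    by (intro tendsto_add tendsto_mult tendsto_const)
  then have "(\<lambda>k. \<epsilon> + (a / b) ^ (k - k0) * (J / m)) \<longlonglongrightarrow> \<epsilon>"
    by - (rule LIMSEQ_offset[where k = k0], simp)
  moreover have "\<epsilon> < e" using \<open>0 < e\<close> by (simp add: \<epsilon>_def)
  ultimately have "\<forall>\<^sub>F k in sequentially. \<epsilon> + (a / b) ^ (k - k0) * (J / m) < e"
    by (rule order_tendstoD(2))
  moreover have "\<forall>\<^sub>F k in sequentially. k0 \<le> k"
    by (rule eventually_ge_at_top)
  ultimately show "\<forall>\<^sub>F k in sequentially.
      dist (inverse (\<integral>x. F x ^ k \<partial>M) *\<^sub>R (\<integral>x. F x ^ k *\<^sub>R f x \<partial>M)) 0 < e"
  proof eventually_elim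
    case (elim k)
    then show ?case using bound[OF elim(2)] by (simp add: I_def)
  qed
qed

text \<open>The part of \<open>interior K\<close> outside \<open>A\<close> is open and null, hence
  empty; and \<open>K\<close> is the closure of its interior.\<close>

lemma convex_body_subset_of_full_measure:
  assumes K: "convex_body K" and A: "closed A" and m: "measure lebesgue (A \<inter> K) = measure lebesgue K"
  shows "K \<subseteq> A"
proof -
  have cK: "compact K" "convex K" "interior K \<noteq> {}" using K by (auto simp: convex_body_def)
  have lm: "K \<in> lmeasurable" "A \<inter> K \<in> lmeasurable"
    using cK(1) closed_Int_compact[OF A cK(1)] by (auto intro: lmeasurable_compact)
  have "measure lebesgue (K - A \<inter> K) = 0"
    using measurable_measure_Diff[OF lm(1) fmeasurableD[OF lm(2)]] m by simp
  then have "negligible (K - A \<inter> K)"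
    using lm by (simp add: negligible_iff_measure fmeasurable.Diff)
  moreover have "interior K - A \<subseteq> K - A \<inter> K"
    using interior_subset[of K] by auto
  ultimately have "negligible (interior K - A)"
    using negligible_subset by blast
  moreover have "open (interior K - A)"
    using A by (simp add: open_Diff)
  ultimately have "interior K \<subseteq> A"
    using open_not_negligible by blast
  then have "closure (interior K) \<subseteq> A"
    using A by (rule closure_minimal)
  then show ?thesis
    using convex_closure_interior[OF cK(2,3)] cK(1) by (simp add: compact_imp_closed)
qed

text \<open>Full overlap gives the inclusion of the image in \<open>K\<close>. The image has the
  same volume as \<open>K\<close>, so the same principle yields the reverse inclusion.\<close>

lemma aff_image_eq_of_full_overlap:
  assumes K: "convex_body K" and \<phi>: "fst \<phi> \<in> unimodular_matrices"
    and full: "overlap K K \<phi> = measure lebesgue K"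
  shows "aff \<phi> ` K = K"
proof
  have cK: "compact K" "closed K" using K by (auto simp: convex_body_def compact_imp_closed)
  have "K \<subseteq> aff \<phi> -` K"
    using full by (intro convex_body_subset_of_full_measure K closed_aff_vimage cK) (simp add: overlap_def)
  then show sub: "aff \<phi> ` K \<subseteq> K" by auto
  have "measure lebesgue (aff \<phi> ` K) = measure lebesgue K"
    using measure_aff_image[OF lmeasurable_compact[OF cK(1)], of "fst \<phi>" "snd \<phi>"] \<phi>
    by (simp add: unimodular_abs_det)
  moreover have "aff \<phi> ` K \<inter> K = aff \<phi> ` K" using sub by blast
  ultimately show "K \<subseteq> aff \<phi> ` K"
    using compact_imp_closed[OF compact_aff_image[OF cK(1)]]
    by (intro convex_body_subset_of_full_measure K) auto
qed

text \<open>Counterexamples with overlap tending to 1 stay in a compact set and accumulate at a map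
  of full overlap. That map is a symmetry of \<open>K\<close>, so it fixes \<open>v\<close>, against
  the displacement \<open>e\<close> kept in the limit.\<close>

lemma fixed_point_near_full_overlap:
  fixes K :: "(real ^ 'n) set"
  assumes K: "convex_body K" and vol: "measure lebesgue K = 1" and v: "v \<in> fixed_points K"
    and e: "0 < e"
  shows "\<exists>a<1. \<forall>\<phi>\<in>unimodular_matrices \<times> UNIV. a < overlap K K \<phi> \<longrightarrow> norm (aff \<phi> v - v) \<le> e"
proof (rule ccontr)
  assume neg: "\<not> ?thesis"
  have cK: "compact K" "closed K" using K by (auto simp: convex_body_def compact_imp_closed)
  \<comment> \<open>\<open>Suc (Suc j)\<close> keeps every overlap at least 1/2, already for
    \<open>j = 0\<close>; the decay bound then gives
    \<open>norm (fst (\<Phi> j)) \<le> 2 * C\<close>.\<close>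
  have "\<exists>\<phi>. \<phi> \<in> unimodular_matrices \<times> UNIV \<and> 1 - inverse (real (Suc (Suc j))) < overlap K K \<phi> \<and>
      e < norm (aff \<phi> v - v)" for j
  proof -
    have "1 - inverse (real (Suc (Suc j))) < 1" by simp
    with neg show ?thesis by (meson not_less)
  qed
  then obtain \<Phi> where \<Phi>: "\<And>j. \<Phi> j \<in> unimodular_matrices \<times> UNIV"
    "\<And>j. 1 - inverse (real (Suc (Suc j))) < overlap K K (\<Phi> j)" "\<And>j. e < norm (aff (\<Phi> j) v - v)"
    by metis
  obtain \<rho> where \<rho>: "0 < \<rho>" "K \<subseteq> ball 0 \<rho>"
    using bounded_subset_ballD[OF compact_imp_bounded[OF cK(1)]] by blast
  then have sub: "K \<subseteq> cball 0 \<rho>" using ball_subset_cball by blast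
  obtain C where C: "0 \<le> C" "\<And>\<phi>. overlap K K \<phi> * (1 + norm (fst \<phi>)) \<le> C"
    using overlap_decay[OF cK(1), of \<rho>] cK(2) sub by metis
  let ?S = "(unimodular_matrices \<inter> cball 0 (2 * C)) \<times> cball (0 :: real ^ 'n) (\<rho> * (1 + 2 * C))"
  have "\<Phi> j \<in> ?S" for j
  proof -
    have "inverse (real (Suc (Suc j))) \<le> 1 / 2" by (simp add: field_simps)
    then have half: "1 / 2 \<le> overlap K K (\<Phi> j)" using \<Phi>(2)[of j] by linarith
    have "1 / 2 * (1 + norm (fst (\<Phi> j))) \<le> overlap K K (\<Phi> j) * (1 + norm (fst (\<Phi> j)))"
      using half by (intro mult_right_mono) auto
    from order_trans[OF this C(2)] have n: "norm (fst (\<Phi> j)) \<le> 2 * C"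
      by simp
    have "norm (snd (\<Phi> j)) \<le> \<rho> * (1 + norm (fst (\<Phi> j)))"
      using half by (intro overlap_support[OF sub sub]) auto
    also have "\<dots> \<le> \<rho> * (1 + 2 * C)"
      using n \<rho>(1) by (intro mult_left_mono) auto
    finally show ?thesis
      using n \<Phi>(1)[of j] by (simp add: mem_Times_iff)
  qed
  moreover have "compact ?S"
    by (intro compact_Times closed_Int_compact closed_unimodular_matrices compact_cball)
  ultimately obtain \<phi> s where s: "\<phi> \<in> ?S" "strict_mono s" "(\<Phi> \<circ> s) \<longlonglongrightarrow> \<phi>"
    by (metis seq_compactE compact_imp_seq_compact)
  then have \<phi>: "\<phi> \<in> unimodular_matrices \<times> UNIV" by auto
  have "(overlap K K \<circ> (\<Phi> \<circ> s)) \<longlonglongrightarrow> overlap K K \<phi>"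
    using continuous_on_overlap[OF cK(1) K] \<phi> s(3) \<Phi>(1) unfolding continuous_on_sequentially by auto
  moreover have "(\<lambda>j. overlap K K (\<Phi> j)) \<longlonglongrightarrow> 1"
  proof (rule tendsto_sandwich[OF _ _ _ tendsto_const])
    show "(\<lambda>j. 1 - inverse (real (Suc (Suc j)))) \<longlonglongrightarrow> 1"
      using tendsto_diff[OF tendsto_const[of 1] LIMSEQ_Suc[OF LIMSEQ_inverse_real_of_nat]] by simp
  qed (use \<Phi>(2) overlap_le_measure[OF cK] vol in \<open>auto simp: less_imp_le\<close>)
  then have "(overlap K K \<circ> (\<Phi> \<circ> s)) \<longlonglongrightarrow> 1"
    using LIMSEQ_subseq_LIMSEQ[OF _ s(2)] by (simp add: o_def)
  ultimately have "overlap K K \<phi> = 1"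
    by (rule LIMSEQ_unique)
  then have "aff \<phi> ` K = K"
    using \<phi> vol by (intro aff_image_eq_of_full_overlap K) auto
  then have "aff \<phi> v = v" using v unfolding fixed_points_def by blast
  have "(\<lambda>j. norm (aff ((\<Phi> \<circ> s) j) v - v)) \<longlonglongrightarrow> norm (aff \<phi> v - v)"
    by (intro tendsto_intros s(3))
  then have "e \<le> norm (aff \<phi> v - v)"
    by (rule LIMSEQ_le_const) (use \<Phi>(3) in \<open>auto intro: less_imp_le\<close>)
  with e \<open>aff \<phi> v = v\<close> show False by simp
qed

context unimodular_haar
begin

text \<open>Subtracting \<open>v\<close> turns the claim into the vanishing of the weighted mean of
  the displacement \<open>aff \<phi> v - v\<close>. The identity has overlap 1, so all superlevel
  sets below 1 have positive measure.\<close>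

lemma T_unit_tendsto:
  assumes K: "convex_body K" and vol: "measure lebesgue K = 1" and v: "v \<in> fixed_points K"
  shows "(\<lambda>k. T_unit \<nu> k K v K) \<longlonglongrightarrow> v"
proof -
  have cK: "compact K" "closed K" using K by (auto simp: convex_body_def compact_imp_closed)
  obtain k0 where k0: "1 \<le> k0" "\<And>k. k0 \<le> k \<Longrightarrow> T_unit_defined \<nu> k K v K"
    using T_unit_defined_of_large_power[OF cK(1)] K by metis
  have int: "integrable P (\<lambda>\<phi>. overlap K K \<phi> ^ k)" "integrable P (\<lambda>\<phi>. overlap K K \<phi> ^ k *\<^sub>R aff \<phi> v)"
    if "k0 \<le> k" for k
    using k0(2)[OF that] by (auto simp: T_unit_defined_def)
  have int': "integrable P (\<lambda>\<phi>. overlap K K \<phi> ^ k *\<^sub>R (aff \<phi> v - v))" if "k0 \<le> k" for k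
    unfolding scaleR_diff_right using int[OF that] by (intro Bochner_Integration.integrable_diff) auto
  have "(\<lambda>k. inverse (\<integral>\<phi>. overlap K K \<phi> ^ k \<partial>P) *\<^sub>R (\<integral>\<phi>. overlap K K \<phi> ^ k *\<^sub>R (aff \<phi> v - v) \<partial>P)) \<longlonglongrightarrow> 0"
  proof (rule power_weighted_mean_tendsto_0[where ?k0.0 = k0])
    show "overlap K K \<in> borel_measurable P" by (rule borel_measurable_overlap[OF cK(1) K])
    show "overlap K K \<phi> \<le> 1" for \<phi> using overlap_le_measure[OF cK] vol by simp
    show "\<exists>a<1. \<forall>\<phi>\<in>space P. a < overlap K K \<phi> \<longrightarrow> norm (aff \<phi> v - v) \<le> e" if "0 < e" for e
      unfolding space_saff by (rule fixed_point_near_full_overlap[OF K vol v that])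
    show "0 < emeasure P {\<phi> \<in> space P. b < overlap K K \<phi>}" if "b < 1" for b
    proof (rule emeasure_superlevel_pos[where x = 0])
      show "continuous_on (G \<times> UNIV) (overlap K K)" by (rule continuous_on_overlap[OF cK(1) K])
      show "b < overlap K K (mat 1, 0)" using that vol by (simp add: overlap_def)
    qed
  qed (use int int' overlap_nonneg in auto)
  then have lim: "(\<lambda>k. inverse (\<integral>\<phi>. overlap K K \<phi> ^ k \<partial>P) *\<^sub>R
      (\<integral>\<phi>. overlap K K \<phi> ^ k *\<^sub>R (aff \<phi> v - v) \<partial>P) + v) \<longlonglongrightarrow> 0 + v"
    by (intro tendsto_add tendsto_const)
  \<comment> \<open>Only from \<open>k0\<close> on: for smaller \<open>k\<close> the integrals may
    diverge, and their default value 0 need not respect the splitting.\<close>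
  have "inverse (\<integral>\<phi>. overlap K K \<phi> ^ k \<partial>P) *\<^sub>R (\<integral>\<phi>. overlap K K \<phi> ^ k *\<^sub>R (aff \<phi> v - v) \<partial>P) + v
      = T_unit \<nu> k K v K" if k: "k0 \<le> k" for k
  proof -
    have "(\<integral>\<phi>. overlap K K \<phi> ^ k *\<^sub>R (aff \<phi> v - v) \<partial>P) =
        (\<integral>\<phi>. overlap K K \<phi> ^ k *\<^sub>R aff \<phi> v \<partial>P) - (\<integral>\<phi>. overlap K K \<phi> ^ k \<partial>P) *\<^sub>R v"
      unfolding scaleR_diff_right using int[OF k] by (simp add: Bochner_Integration.integral_diff)
    moreover have "(\<integral>\<phi>. overlap K K \<phi> ^ k \<partial>P) \<noteq> 0"
      using integral_overlap_power_pos[OF K K int(1)[OF k]] by simp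
    ultimately show ?thesis
      by (simp add: T_unit_def scaleR_diff_right)
  qed
  then have "\<forall>\<^sub>F k in sequentially. inverse (\<integral>\<phi>. overlap K K \<phi> ^ k \<partial>P) *\<^sub>R
      (\<integral>\<phi>. overlap K K \<phi> ^ k *\<^sub>R (aff \<phi> v - v) \<partial>P) + v = T_unit \<nu> k K v K"
    by (auto simp: eventually_sequentially)
  from Lim_transform_eventually[OF lim this] show ?thesis by simp
qed

end

text \<open>Conjugation with the dilation by \<open>s\<close> turns a symmetry \<open>\<phi>\<close>
  of \<open>normalized K\<close> into the symmetry \<open>\<psi>\<close> of \<open>K\<close>: the
  matrix stays and the translation is multiplied by \<open>s\<close>.\<close>

lemma fixed_points_normalized:
  assumes K: "convex_body K" and v: "v \<in> fixed_points K"
  shows "v /\<^sub>R vol_root K \<in> fixed_points (normalized K)"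
  unfolding fixed_points_def
proof (intro CollectI allI impI)
  fix \<phi> assume \<phi>: "aff \<phi> ` normalized K = normalized K"
  define s where "s = vol_root K"
  have s: "0 < s" unfolding s_def by (rule vol_root_pos[OF K])
  define \<psi> where "\<psi> = (fst \<phi>, s *\<^sub>R snd \<phi>)"
  have \<psi>: "aff \<psi> (s *\<^sub>R y) = s *\<^sub>R aff \<phi> y" for y
    by (simp add: \<psi>_def aff_def scaleR_right_distrib matrix_vector_mult_scaleR)
  have eq: "K = (\<lambda>y. s *\<^sub>R y) ` normalized K"
    using s by (simp add: normalized_def s_def[symmetric] image_image)
  have "aff \<psi> ` K = (\<lambda>y. s *\<^sub>R y) ` (aff \<phi> ` normalized K)"
    by (subst eq) (simp add: image_image \<psi>)
  then have "aff \<psi> ` K = K" using \<phi> eq by simp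
  then have "aff \<psi> v = v" using v unfolding fixed_points_def by blast
  moreover have "aff \<psi> v = s *\<^sub>R aff \<phi> (v /\<^sub>R s)"
    using \<psi>[of "v /\<^sub>R s"] s by simp
  ultimately show "aff \<phi> (v /\<^sub>R vol_root K) = v /\<^sub>R vol_root K"
    using s unfolding s_def[symmetric] by (metis scaleR_scaleR left_inverse less_irrefl scaleR_one)
qed

text \<open>The limit appears twice: for \<open>K\<close> of volume 1 as it stands, and for
  \<open>K\<close> of any volume after normalizing the reference body and scaling \<open>v\<close>
  along with it. In the second form \<open>T_point\<close> scales the limit back to
  \<open>v\<close>.\<close>

theorem theorem3p1:
  fixes \<nu> :: "(real ^ 'n ^ 'n) measure"
    and K :: "(real ^ 'n) set"
    and v :: "real ^ 'n"
  assumes "left_haar_measure (**) unimodular_matrices \<nu>"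
    and "convex_body K"
    and "v \<in> fixed_points K"
  shows "(\<exists>k0\<ge>1. \<forall>k\<ge>k0. \<forall>L. convex_body L \<longrightarrow> T_defined \<nu> k K v L) \<and>
    (\<forall>k\<ge>1. (\<forall>L. convex_body L \<longrightarrow> T_defined \<nu> k K v L)
        \<longrightarrow> affine_invariant_point (T_point \<nu> k K v)) \<and>
    (measure lebesgue K = 1 \<longrightarrow> (\<lambda>k. T_point \<nu> k K v K) \<longlonglongrightarrow> v) \<and>
    (\<lambda>k. T_point \<nu> k (normalized K) (v /\<^sub>R vol_root K) K) \<longlonglongrightarrow> v"
proof (intro conjI)
  interpret unimodular_haar \<nu>
    by unfold_locales (rule assms(1))
  have K: "compact K" using assms(2) by (simp add: convex_body_def)
  show "\<exists>k0\<ge>1. \<forall>k\<ge>k0. \<forall>L. convex_body L \<longrightarrow> T_defined \<nu> k K v L"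
  proof -
    obtain k0 where "1 \<le> k0" "\<And>k L. k0 \<le> k \<Longrightarrow> convex_body L \<Longrightarrow> T_unit_defined \<nu> k K v L"
      using T_unit_defined_of_large_power[OF K] by metis
    then show ?thesis
      by (auto simp: T_defined_def convex_body_normalized)
  qed
  show "\<forall>k\<ge>1. (\<forall>L. convex_body L \<longrightarrow> T_defined \<nu> k K v L)
      \<longrightarrow> affine_invariant_point (T_point \<nu> k K v)"
    using affine_invariant_T_point[OF assms(2)] by blast
  show "measure lebesgue K = 1 \<longrightarrow> (\<lambda>k. T_point \<nu> k K v K) \<longlonglongrightarrow> v"
    using T_unit_tendsto[OF assms(2) _ assms(3)]
    by (auto simp: T_point_def normalized_unit vol_root_def)
  have "(\<lambda>k. vol_root K *\<^sub>R T_unit \<nu> k (normalized K) (v /\<^sub>R vol_root K) (normalized K))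
      \<longlonglongrightarrow> vol_root K *\<^sub>R (v /\<^sub>R vol_root K)"
    by (intro tendsto_scaleR tendsto_const T_unit_tendsto convex_body_normalized[OF assms(2)]
        measure_normalized[OF assms(2)] fixed_points_normalized[OF assms(2,3)])
  then show "(\<lambda>k. T_point \<nu> k (normalized K) (v /\<^sub>R vol_root K) K) \<longlonglongrightarrow> v"
    using vol_root_pos[OF assms(2)] by (simp add: T_point_def)
qed

end
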